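(* Assume that $\mathrm{zer}(G)\neq\emptyset$ and that $G=\frac1n\sum_{i=1}^nG_i$ satisfies, for some $L\in(0,+\infty)$ and all $x,y\in\mathbb{R}^p$, $$\frac1n\sum_{i=1}^n\langle G_ix-G_iy,x-y\rangle\ \ge\ \frac1L\Big[\frac1n\sum_{i=1}^n\|G_ix-G_iy\|^2\Big].$$ Let $\{x^k\}$ be generated by the method (VFKM) using a variance-reduced unbiased estimator $\widetilde S^k$ of $S^k$ with constants $\rho\in(0,1)$, $\Theta>0$, $\hat\Theta\ge0$ and sequence $\{\Delta_k\}$ such that $\Delta_0=0$ almost surely. Let $r>2$ and $\beta\in(0,\bar\beta)$, where $\bar\beta:=\min\big\{\frac{\rho}{[\rho+(r+1)(\Theta+\hat\Theta)]L},\frac{1}{(r+1)L}\big\}$, and let $$\theta_k:=\frac{k}{k+r+2},\qquad \gamma_k:=\frac{k}{k+r},\qquad \eta_k:=\frac{2\beta(k+r)}{k+r+2}.$$ Then $$\lim_{k\to\infty}k^2\|x^{k+1}-x^k\|^2=0\quad\text{and}\quad\lim_{k\to\infty}k^2\|Gx^k\|^2=0\quad\text{almost surely.}$$ Moreover, $\{x^k\}$ converges almost surely to a $\mathrm{zer}(G)$-valued random variable.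
   Context: Setting. $n,p\ge1$ are integers, $[n]=\{1,\dots,n\}$, $G_i:\mathbb{R}^p\to\mathbb{R}^p$ ($i\in[n]$) are single-valued mappings, $Gx:=\frac1n\sum_{i=1}^nG_ix$, and $\mathrm{zer}(G):=\{x^\star\in\mathbb{R}^p: Gx^\star=0\}$. Method (VFKM). Given (deterministic) $x^0\in\mathbb{R}^p$, set $x^{-1}:=x^0$. At each iteration $k\ge0$ let $S^k:=Gx^k-\gamma_kGx^{k-1}$, construct a random estimator $\widetilde S^k$ of $S^k$ (with $\widetilde S^0:=S^0$), and update $x^{k+1}:=x^k+\theta_k(x^k-x^{k-1})-\eta_k\widetilde S^k$. Variance-reduced unbiased estimator. $\mathcal{F}_k$ is the $\sigma$-algebra containing all information generated by the algorithm up to iteration $k$ before constructing $\widetilde S^k$ (so $x^0,\dots,x^k$ and $\Delta_0,\dots,\Delta_{k-1}$ are $\mathcal{F}_k$-measurable), and $\mathbb{E}_k[\cdot]:=\mathbb{E}[\cdot\mid\mathcal{F}_k]$. $\widetilde S^k$, constructed using fresh randomness conditionally on $\mathcal{F}_k$, is a variance-reduced unbiased estimator of $S^k$ if there exist $\rho\in(0,1)$, $\Theta>0$, $\hat\Theta\ge0$ and nonnegative random variables $\{\Delta_k\}$ such that for all $k\ge1$, almost surely: $\mathbb{E}_k[\widetilde S^k-S^k]=0$; $\mathbb{E}_k[\|\widetilde S^k-S^k\|^2]\le\mathbb{E}_k[\Delta_k]$; and $$\tfrac{1}{(1-\gamma_k)^2}\mathbb{E}_k[\Delta_k]\le\tfrac{1-\rho}{(1-\gamma_{k-1})^2}\Delta_{k-1}+\tfrac{\Theta}{(1-\gamma_k)^2}U_k+\tfrac{\hat\Theta}{(1-\gamma_{k-1})^2}U_{k-1},$$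 where $U_k:=\frac1n\sum_{i=1}^n\|G_ix^k-G_ix^{k-1}\|^2$ (so $U_0=0$). *)

theory Defs
  imports "HOL-Probability.Probability"
begin

definition avg_map :: "nat \<Rightarrow> (nat \<Rightarrow> real^'p \<Rightarrow> real^'p) \<Rightarrow> real^'p \<Rightarrow> real^'p" where
  "avg_map n G x = (1 / real n) *\<^sub>R (\<Sum>i\<in>{1..n}. G i x)"

definition zer :: "(real^'p \<Rightarrow> real^'p) \<Rightarrow> (real^'p) set" where
  "zer T = {x. T x = 0}"

definition avg_cocoercive ::
    "nat \<Rightarrow> (nat \<Rightarrow> real^'p \<Rightarrow> real^'p) \<Rightarrow> real \<Rightarrow> bool" where
  "avg_cocoercive n G L \<longleftrightarrow>
     (\<forall>x y. (1 / real n) * (\<Sum>i\<in>{1..n}. (G i x - G i y) \<bullet> (x - y))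
        \<ge> (1 / L) * ((1 / real n) * (\<Sum>i\<in>{1..n}. (norm (G i x - G i y))\<^sup>2)))"

text \<open>
  Processes have type nat => 'a => real^'p. In the next three definitions the iterate preceding
  x k is x (k - 1); as subtraction on nat truncates, for k = 0 this is x 0, which is the
  convention that the iterate with index -1 equals x 0.
\<close>

definition S_dir ::
    "nat \<Rightarrow> (nat \<Rightarrow> real^'p \<Rightarrow> real^'p) \<Rightarrow> (nat \<Rightarrow> real)
      \<Rightarrow> (nat \<Rightarrow> 'a \<Rightarrow> real^'p) \<Rightarrow> nat \<Rightarrow> 'a \<Rightarrow> real^'p" where
  "S_dir n G \<gamma> x k \<omega> = avg_map n G (x k \<omega>) - \<gamma> k *\<^sub>R avg_map n G (x (k - 1) \<omega>)"

definition U_diff ::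
    "nat \<Rightarrow> (nat \<Rightarrow> real^'p \<Rightarrow> real^'p)
      \<Rightarrow> (nat \<Rightarrow> 'a \<Rightarrow> real^'p) \<Rightarrow> nat \<Rightarrow> 'a \<Rightarrow> real" where
  "U_diff n G x k \<omega> =
     (1 / real n) * (\<Sum>i\<in>{1..n}. (norm (G i (x k \<omega>) - G i (x (k - 1) \<omega>)))\<^sup>2)"

definition vfkm_iterates ::
    "'a measure \<Rightarrow> nat \<Rightarrow> (nat \<Rightarrow> real^'p \<Rightarrow> real^'p)
      \<Rightarrow> (nat \<Rightarrow> real) \<Rightarrow> (nat \<Rightarrow> real) \<Rightarrow> (nat \<Rightarrow> real)
      \<Rightarrow> real^'p \<Rightarrow> (nat \<Rightarrow> 'a \<Rightarrow> real^'p) \<Rightarrow> (nat \<Rightarrow> 'a \<Rightarrow> real^'p) \<Rightarrow> bool" where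
  "vfkm_iterates M n G \<theta> \<gamma> \<eta> x0 St x \<longleftrightarrow>
     (\<forall>\<omega>\<in>space M.
        x 0 \<omega> = x0 \<and>
        St 0 \<omega> = S_dir n G \<gamma> x 0 \<omega> \<and>
        (\<forall>k. x (k + 1) \<omega> = x k \<omega> + \<theta> k *\<^sub>R (x k \<omega> - x (k - 1) \<omega>) - \<eta> k *\<^sub>R St k \<omega>))"

definition vec_cond_exp ::
    "'a measure \<Rightarrow> 'a measure \<Rightarrow> ('a \<Rightarrow> real^'p) \<Rightarrow> 'a \<Rightarrow> real^'p" where
  "vec_cond_exp M F f \<omega> = (\<chi> i. real_cond_exp M F (\<lambda>\<omega>'. f \<omega>' $ i) \<omega>)"

text \<open>
  F k is the information available before St k is constructed, so x k is F k-measurable,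
  whereas St k and D k are only F (k + 1)-measurable. F may carry more information than the
  processes x, St and D (e.g. sampled indices).

  Conditional expectations of nonnegative variables are taken in ennreal, so no integrability is
  presupposed. The last condition bounds that of D k by a finite quantity, hence the conditional
  second moment of the error St k - S k is almost surely finite, and so the totalised
  real_cond_exp in the unbiasedness condition is the genuine conditional expectation.
\<close>

definition vr_unbiased_estimator ::
    "'a measure \<Rightarrow> (nat \<Rightarrow> 'a measure) \<Rightarrow> nat \<Rightarrow> (nat \<Rightarrow> real^'p \<Rightarrow> real^'p)
      \<Rightarrow> (nat \<Rightarrow> real) \<Rightarrow> (nat \<Rightarrow> 'a \<Rightarrow> real^'p) \<Rightarrow> (nat \<Rightarrow> 'a \<Rightarrow> real^'p)
      \<Rightarrow> real \<Rightarrow> real \<Rightarrow> real \<Rightarrow> (nat \<Rightarrow> 'a \<Rightarrow> real) \<Rightarrow> bool" where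
  "vr_unbiased_estimator M F n G \<gamma> x St \<rho> \<Theta> \<Theta>' D \<longleftrightarrow>
     filtration (space M) F \<and> (\<forall>k. subalgebra M (F k)) \<and>
     (\<forall>k. x k \<in> borel_measurable (F k)) \<and>
     (\<forall>k. St k \<in> borel_measurable (F (k + 1))) \<and>
     (\<forall>k. D k \<in> borel_measurable (F (k + 1))) \<and>
     (\<forall>k. \<forall>\<omega>\<in>space M. 0 \<le> D k \<omega>) \<and>
     0 < \<rho> \<and> \<rho> < 1 \<and> 0 < \<Theta> \<and> 0 \<le> \<Theta>' \<and>
     (\<forall>k\<ge>1.
        (AE \<omega> in M. vec_cond_exp M (F k) (\<lambda>\<omega>. St k \<omega> - S_dir n G \<gamma> x k \<omega>) \<omega> = 0) \<and>
        (AE \<omega> in M.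
           nn_cond_exp M (F k) (\<lambda>\<omega>. ennreal ((norm (St k \<omega> - S_dir n G \<gamma> x k \<omega>))\<^sup>2)) \<omega>
             \<le> nn_cond_exp M (F k) (\<lambda>\<omega>. ennreal (D k \<omega>)) \<omega>) \<and>
        (AE \<omega> in M.
           ennreal (1 / (1 - \<gamma> k)\<^sup>2) * nn_cond_exp M (F k) (\<lambda>\<omega>. ennreal (D k \<omega>)) \<omega>
             \<le> ennreal ((1 - \<rho>) / (1 - \<gamma> (k - 1))\<^sup>2 * D (k - 1) \<omega>
                 + \<Theta> / (1 - \<gamma> k)\<^sup>2 * U_diff n G x k \<omega>
                 + \<Theta>' / (1 - \<gamma> (k - 1))\<^sup>2 * U_diff n G x (k - 1) \<omega>)))"

end

theory Submission
  imports Defs "HOL-Real_Asymp.Real_Asymp"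
begin

text \<open>
Write \<open>v\<^sup>k = x\<^sup>k - x\<^sup>k\<^sup>-\<^sup>1\<close>, \<open>g\<^sup>k = G x\<^sup>k\<close>, \<open>X\<^sup>k = x\<^sup>k - p\<close> for a zero \<open>p\<close> of \<open>G\<close>, and let
\<open>e\<^sup>k\<close> be the error of the estimator. With the given parameters the iteration reads
\<open>(k + r + 2) v\<^sup>k\<^sup>+\<^sup>1 = k v\<^sup>k - 2\<beta>(k + r) g\<^sup>k + 2\<beta>k g\<^sup>k\<^sup>-\<^sup>1 - 2\<beta>(k + r) e\<^sup>k\<close>,
a discretisation of \<open>t x'' + (r + 2) x' + 2\<beta> t (G x)' + 2\<beta> r G x = 0\<close>. Along this equation the
derivative of \<open>E = s P + Q\<close>, with
\<open>P = (r + 1) |X|\<^sup>2 + 2 t \<langle>X, x' + 2\<beta> G x\<rangle>\<close> and \<open>Q = t\<^sup>2 (|x' + \<beta> G x|\<^sup>2 + \<beta>\<^sup>2 |G x|\<^sup>2)\<close>,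
is a negative multiple of \<open>t\<^sup>2 \<langle>(G x)', x'\<rangle>\<close> and of \<open>\<langle>X, G x\<rangle>\<close>, minus \<open>t\<close> times a quadratic form in
\<open>x'\<close> and \<open>G x\<close> that is positive definite exactly when \<open>(r - 2s)\<^sup>2 < 8 (s - 1)\<close>. As \<open>r > 2\<close>, this leaves
an interval of admissible \<open>s\<close>, and \<open>s = r/2\<close> and \<open>s = r/2 + 1\<close> are two of them.

The discrete energy satisfies an exact identity (\<open>energy_step_identity\<close>) with the same leading terms.
In it the error enters linearly, paired with a vector known before the error is drawn, and
quadratically with a coefficient that tends to 1. The linear part has mean zero. The quadratic part is
controlled by the variance proxy \<open>\<Delta>\<^sub>k\<close>, whose recursion is paid for by the term
\<open>k\<^sup>2 \<langle>g\<^sup>k - g\<^sup>k\<^sup>-\<^sup>1, v\<^sup>k\<rangle> \<ge> k\<^sup>2 U\<^sub>k / L\<close> that cocoercivity provides; the bound on \<open>\<beta>\<close> leaves room for this.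
Hence the energy plus multiples of \<open>\<Delta>\<^sub>k\<^sub>-\<^sub>1\<close> and \<open>U\<^sub>k\<^sub>-\<^sub>1\<close> is, from some index on, a nonnegative
supermartingale (\<open>lyap_descent\<close>), so it converges almost surely and its losses are summable
(\<open>almost_supermartingale_converges\<close>, proved by counting upcrossings).

Since \<open>E\<close> is affine in \<open>s\<close>, convergence for two values of \<open>s\<close> makes \<open>P\<close> and \<open>Q\<close> converge separately.
The losses show that \<open>Q\<^sub>k / k\<close> is summable, so the limit of \<open>Q\<close> is 0: these are the two rates. Then \<open>P\<close>
forces \<open>|x\<^sup>k - p|\<close> to converge (\<open>energies_control_sequence\<close>). Applying this to countably many \<open>p\<close> that
are dense in the set of zeros, Opial's argument gives a limit that is itself a zero (\<open>opial\<close>).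
\<close>

section \<open>Almost sure convergence of nonnegative supermartingales\<close>

lemma AE_summable_of_summable_integrals:
  fixes W :: "nat \<Rightarrow> 'a \<Rightarrow> real"
  assumes int: "\<And>j. integrable M (W j)" and nonneg: "\<And>j \<omega>. \<omega> \<in> space M \<Longrightarrow> 0 \<le> W j \<omega>"
    and summ: "summable (\<lambda>j. integral\<^sup>L M (W j))"
  shows "AE \<omega> in M. summable (\<lambda>j. W j \<omega>)"
proof -
  have [measurable]: "\<And>j. W j \<in> borel_measurable M" using int by auto
  have nn: "0 \<le> integral\<^sup>L M (W j)" for j
    by (intro integral_nonneg_AE AE_I2 nonneg)
  have "(\<integral>\<^sup>+\<omega>. ennreal (W j \<omega>) \<partial>M) = ennreal (integral\<^sup>L M (W j))" for j
    by (intro nn_integral_eq_integral int AE_I2 nonneg)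
  then have "(\<integral>\<^sup>+\<omega>. (\<Sum>j. ennreal (W j \<omega>)) \<partial>M) \<noteq> \<infinity>"
    using summ by (simp add: nn_integral_suminf suminf_ennreal2 nn)
  then have "AE \<omega> in M. (\<Sum>j. ennreal (W j \<omega>)) \<noteq> \<infinity>"
    by (intro nn_integral_PInf_AE) auto
  then show ?thesis
    using AE_space by eventually_elim (auto intro!: summable_suminf_not_top nonneg)
qed

text \<open>
The strategy behind Doob's upcrossing inequality: buy when the price \<open>y\<close> is below \<open>a\<close>, sell once it
exceeds \<open>b\<close>. The predicate tells whether the asset is held from time \<open>k\<close> to time \<open>k + 1\<close>.
\<close>

primrec holding :: "real \<Rightarrow> real \<Rightarrow> (nat \<Rightarrow> real) \<Rightarrow> nat \<Rightarrow> bool" where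
  "holding a b y 0 \<longleftrightarrow> y 0 < a"
| "holding a b y (Suc k) \<longleftrightarrow> (if holding a b y k then y (Suc k) \<le> b else y (Suc k) < a)"

text \<open>
Each completed round trip earns at least \<open>b - a\<close>. An asset still held was bought below \<open>a\<close>, so the
open position is worth at least \<open>y k - a\<close>; carrying this term along is what makes the induction work.
\<close>

lemma gain_ge_sales:
  assumes "0 \<le> a" "a < b" "\<And>k. 0 \<le> y k"
  shows "(b - a) * (\<Sum>j<k. of_bool (holding a b y j \<and> \<not> holding a b y (Suc j)))
           + (if holding a b y k then y k - a else 0)
         \<le> (\<Sum>j<k. of_bool (holding a b y j) * (y (Suc j) - y j))"
proof (induction k)
  case 0
  show ?case by simp
next
  case (Suc k)
  show ?case
    using Suc assms by (cases "holding a b y k") (auto simp: algebra_simps split: if_splits)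
qed

text \<open>
After the last sale the strategy either holds for ever, and then the price never exceeds \<open>b\<close> again,
or never buys again, and then the price never falls below \<open>a\<close>.
\<close>

lemma finitely_many_sales_imp_no_oscillation:
  assumes "\<forall>\<^sub>F j in sequentially. \<not> (holding a b y j \<and> \<not> holding a b y (Suc j))"
  shows "(\<forall>\<^sub>F j in sequentially. y j \<le> b) \<or> (\<forall>\<^sub>F j in sequentially. a \<le> y j)"
proof -
  obtain J where J: "\<And>j. J \<le> j \<Longrightarrow> holding a b y j \<Longrightarrow> holding a b y (Suc j)"
    using assms unfolding eventually_sequentially by auto
  show ?thesis
  proof (cases "\<exists>i\<ge>J. holding a b y i")
    case True
    then obtain i where i: "J \<le> i" "holding a b y i" by auto
    have "holding a b y j" if "i \<le> j" for j
      using that by (induction j rule: dec_induct) (use i J in auto)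
    then have "y (Suc j) \<le> b" if "i \<le> j" for j
      using that by (metis holding.simps(2) le_SucI)
    then have "y j \<le> b" if "Suc i \<le> j" for j
      using that by (cases j) auto
    then show ?thesis unfolding eventually_sequentially by blast
  next
    case False
    then have "a \<le> y (Suc j)" if "J \<le> j" for j
      using that holding.simps(2)[of a b y j] by (metis le_SucI not_less)
    then have "a \<le> y j" if "Suc J \<le> j" for j
      using that by (cases j) auto
    then show ?thesis unfolding eventually_sequentially by blast
  qed
qed

text \<open>
If the lower and upper limits differed, two rational levels would separate them. Restricting to
rational levels keeps the exceptional null sets countable in number below.
\<close>

lemma convergent_if_no_oscillation:
  fixes y :: "nat \<Rightarrow> real"
  assumes nonneg: "\<And>k. 0 \<le> y k"
    and osc: "\<And>a b. a \<in> \<rat> \<Longrightarrow> b \<in> \<rat> \<Longrightarrow> 0 < a \<Longrightarrow> a < b \<Longrightarrow>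
      (\<forall>\<^sub>F j in sequentially. y j \<le> b) \<or> (\<forall>\<^sub>F j in sequentially. a \<le> y j)"
    and fin: "liminf (\<lambda>k. ennreal (y k)) \<noteq> \<infinity>"
  shows "convergent y"
proof -
  let ?l = "liminf (\<lambda>k. ennreal (y k))" and ?u = "limsup (\<lambda>k. ennreal (y k))"
  have "?u \<le> ?l"
  proof (rule ccontr)
    assume "\<not> ?u \<le> ?l"
    then have "?l < ?u" by simp
    then obtain p q where pq: "?l < p" "p < q" "q < ?u"
      using dense by metis
    then have "p \<noteq> top" "q \<noteq> top" by auto
    then obtain p' q' where p': "p = ennreal p'" "0 \<le> p'" and q': "q = ennreal q'" "0 \<le> q'"
      by (metis ennreal_cases)
    then have "p' < q'" using pq by (simp add: ennreal_less_iff)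
    then obtain a b where ab: "p' < a" "a < b" "b < q'" "a \<in> \<rat>" "b \<in> \<rat>"
      using Rats_dense_in_real by metis
    then consider "\<forall>\<^sub>F j in sequentially. y j \<le> b" | "\<forall>\<^sub>F j in sequentially. a \<le> y j"
      using osc p'(2) by (metis le_less_trans)
    then show False
    proof cases
      case 1
      then have "?u \<le> ennreal b"
        by (intro Limsup_bounded) (auto elim!: eventually_mono intro: ennreal_leI)
      then show False using pq ab q' by (metis ennreal_leI leD less_imp_le order_trans)
    next
      case 2
      then have "ennreal a \<le> ?l"
        by (intro Liminf_bounded) (auto elim!: eventually_mono intro: ennreal_leI)
      then show False using pq ab p' by (metis ennreal_leI leD less_imp_le order_trans)
    qed
  qed
  then have eq: "?u = ?l"
    by (intro antisym Liminf_le_Limsup) auto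
  obtain l where l: "?l = ennreal l" "0 \<le> l"
    using fin by (metis ennreal_cases infinity_ennreal_def)
  have "(\<lambda>k. ennreal (y k)) \<longlonglongrightarrow> ennreal l"
    using eq l by (intro Liminf_eq_Limsup) auto
  then have "y \<longlonglongrightarrow> l"
    using l nonneg by (simp add: tendsto_ennreal_iff)
  then show ?thesis by (rule convergentI)
qed

context prob_space
begin

text \<open>
The supermartingale property is stated through integrals over events of the past, which is the form
in which it is established later. Holding is such an event, so the strategy has nonpositive expected
gain; as its running loss never exceeds \<open>a\<close>, the expected number of sales is at most \<open>a / (b - a)\<close>. A finite
limit exists because Fatou's lemma bounds the lower limit.
\<close>

theorem nonneg_supermartingale_converges:
  fixes Y :: "nat \<Rightarrow> 'a \<Rightarrow> real"
  assumes sub: "\<And>k. subalgebra M (F k)" and mono: "\<And>k. subalgebra (F (Suc k)) (F k)"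
    and adapted: "\<And>k. Y k \<in> borel_measurable (F k)"
    and int: "\<And>k. integrable M (Y k)" and nonneg: "\<And>k \<omega>. \<omega> \<in> space M \<Longrightarrow> 0 \<le> Y k \<omega>"
    and super: "\<And>k A. A \<in> sets (F k) \<Longrightarrow>
      (\<integral>\<omega>. indicator A \<omega> * Y (Suc k) \<omega> \<partial>M) \<le> (\<integral>\<omega>. indicator A \<omega> * Y k \<omega> \<partial>M)"
  shows "AE \<omega> in M. convergent (\<lambda>k. Y k \<omega>)"
proof -
  have space_F: "space (F k) = space M" for k
    using sub by (simp add: subalgebra_def)
  have Y_M[measurable]: "Y k \<in> borel_measurable M" for k
    by (rule measurable_from_subalg[OF sub adapted])
  have "AE \<omega> in M. (\<forall>\<^sub>F j in sequentially. Y j \<omega> \<le> b) \<or> (\<forall>\<^sub>F j in sequentially. a \<le> Y j \<omega>)"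
    if ab: "0 < a" "a < b" for a b
  proof -
    let ?h = "\<lambda>k \<omega>. holding a b (\<lambda>k. Y k \<omega>) k"
    have meas: "Measurable.pred (F k) (?h k)" for k
    proof (induction k)
      case 0
      show ?case using adapted[of 0] by simp
    next
      case (Suc k)
      have [measurable]: "Measurable.pred (F (Suc k)) (?h k)"
        by (rule measurable_from_subalg[OF mono Suc])
      have [measurable]: "Y (Suc k) \<in> borel_measurable (F (Suc k))" by (rule adapted)
      show ?case by simp
    qed
    have [measurable]: "Measurable.pred M (?h k)" for k
      by (rule measurable_from_subalg[OF sub meas])
    define B where "B k = {\<omega> \<in> space M. ?h k \<omega>}" for k
    have B_sets: "B k \<in> sets (F k)" for k
      using meas[of k] by (simp add: pred_def B_def space_F)
    have B_M[measurable]: "B k \<in> sets M" for k unfolding B_def by simp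
    have int_B: "integrable M (\<lambda>\<omega>. indicator (B k) \<omega> * Y j \<omega>)" for k j
      using int[of j] B_M[of k] by (intro integrable_mult_indicator[of "B k" M "Y j", simplified]) auto
    let ?s = "\<lambda>j \<omega>. of_bool (?h j \<omega> \<and> \<not> ?h (Suc j) \<omega>) :: real"
    have int_s: "integrable M (?s j)" for j
      by (intro integrable_const_bound[where B = 1]) auto
    let ?gain = "\<lambda>j \<omega>. indicator (B j) \<omega> * (Y (Suc j) \<omega> - Y j \<omega>)"
    have int_gain: "integrable M (?gain j)" for j
      using int_B by (simp add: right_diff_distrib)
    have gain_le: "integral\<^sup>L M (?gain j) \<le> 0" for j
      using super[OF B_sets, of j] int_B by (simp add: right_diff_distrib)
    have "(\<Sum>j<k. integral\<^sup>L M (?s j)) \<le> a / (b - a)" for k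
    proof -
      have "(\<integral>\<omega>. (b - a) * (\<Sum>j<k. ?s j \<omega>) \<partial>M) \<le> (\<integral>\<omega>. (\<Sum>j<k. ?gain j \<omega>) + a \<partial>M)"
      proof (rule integral_mono)
        fix \<omega> assume \<omega>: "\<omega> \<in> space M"
        have "(b - a) * (\<Sum>j<k. ?s j \<omega>) \<le> (\<Sum>j<k. of_bool (?h j \<omega>) * (Y (Suc j) \<omega> - Y j \<omega>)) + a"
        proof -
          have "- a \<le> (if ?h k \<omega> then Y k \<omega> - a else 0)"
            using ab nonneg[OF \<omega>, of k] by simp
          then show ?thesis
            using gain_ge_sales[OF less_imp_le[OF ab(1)] ab(2), of "\<lambda>k. Y k \<omega>" k] nonneg[OF \<omega>]
            by fastforce
        qed
        also have "(\<Sum>j<k. of_bool (?h j \<omega>) * (Y (Suc j) \<omega> - Y j \<omega>)) = (\<Sum>j<k. ?gain j \<omega>)"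
          using \<omega> by (intro sum.cong) (auto simp: B_def)
        finally show "(b - a) * (\<Sum>j<k. ?s j \<omega>) \<le> (\<Sum>j<k. ?gain j \<omega>) + a" .
      qed (intro integrable_mult_right Bochner_Integration.integrable_sum
          Bochner_Integration.integrable_add int_s int_gain integrable_const)+
      also have "\<dots> = (\<Sum>j<k. integral\<^sup>L M (?gain j)) + a"
        by (simp only: Bochner_Integration.integral_add[OF Bochner_Integration.integrable_sum[OF int_gain]
              integrable_const] Bochner_Integration.integral_sum[OF int_gain]) (simp add: prob_space)
      also have "\<dots> \<le> a"
        by (simp add: sum_nonpos gain_le)
      also have "(\<integral>\<omega>. (b - a) * (\<Sum>j<k. ?s j \<omega>) \<partial>M) = (b - a) * (\<Sum>j<k. integral\<^sup>L M (?s j))"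
        by (simp only: integral_mult_right_zero Bochner_Integration.integral_sum[OF int_s])
      finally show ?thesis using ab by (simp add: field_simps)
    qed
    then have "AE \<omega> in M. summable (\<lambda>j. ?s j \<omega>)"
      by (intro AE_summable_of_summable_integrals int_s summableI_nonneg_bounded[where x = "a / (b - a)"]) auto
    then show ?thesis
    proof eventually_elim
      case (elim \<omega>)
      then have "\<forall>\<^sub>F j in sequentially. ?s j \<omega> < 1"
        by (intro order_tendstoD(2)[OF summable_LIMSEQ_zero]) auto
      then show ?case
        by (intro finitely_many_sales_imp_no_oscillation) (auto elim!: eventually_mono)
    qed
  qed
  then have osc: "AE \<omega> in M. \<forall>a\<in>\<rat>. \<forall>b\<in>\<rat>. 0 < a \<longrightarrow> a < b \<longrightarrow>
      (\<forall>\<^sub>F j in sequentially. Y j \<omega> \<le> b) \<or> (\<forall>\<^sub>F j in sequentially. a \<le> Y j \<omega>)"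
    by (auto simp: AE_ball_countable countable_rat)
  have mean_le: "integral\<^sup>L M (Y k) \<le> integral\<^sup>L M (Y 0)" for k
  proof (induction k)
    case (Suc k)
    have "(\<integral>\<omega>. indicator (space M) \<omega> * Y (Suc k) \<omega> \<partial>M) \<le> (\<integral>\<omega>. indicator (space M) \<omega> * Y k \<omega> \<partial>M)"
      using super[of "space M" k] sets.top[of "F k"] by (simp add: space_F)
    then have "integral\<^sup>L M (Y (Suc k)) \<le> integral\<^sup>L M (Y k)"
      by (simp cong: Bochner_Integration.integral_cong)
    then show ?case using Suc by simp
  qed simp
  have "(\<integral>\<^sup>+\<omega>. liminf (\<lambda>k. ennreal (Y k \<omega>)) \<partial>M) \<le> liminf (\<lambda>k. \<integral>\<^sup>+\<omega>. ennreal (Y k \<omega>) \<partial>M)"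
    by (intro nn_integral_liminf) auto
  also have "\<dots> \<le> liminf (\<lambda>k. ennreal (integral\<^sup>L M (Y 0)))"
    using mean_le by (intro Liminf_mono always_eventually)
      (auto simp: nn_integral_eq_integral[OF int] nonneg intro: ennreal_leI)
  finally have "(\<integral>\<^sup>+\<omega>. liminf (\<lambda>k. ennreal (Y k \<omega>)) \<partial>M) \<noteq> \<infinity>"
    by (auto simp: Liminf_const top_unique)
  then have "AE \<omega> in M. liminf (\<lambda>k. ennreal (Y k \<omega>)) \<noteq> \<infinity>"
    by (intro nn_integral_PInf_AE) auto
  with osc AE_space show ?thesis
    by eventually_elim (intro convergent_if_no_oscillation; auto simp: nonneg)
qed

text \<open>
Without its losses \<open>W\<close> the descent inequality is the supermartingale property, and telescoping the
expectations bounds the total expected loss by the expectation of \<open>V 0\<close>.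
\<close>

corollary almost_supermartingale_converges:
  fixes V W :: "nat \<Rightarrow> 'a \<Rightarrow> real"
  assumes sub: "\<And>k. subalgebra M (F k)" and mono: "\<And>k. subalgebra (F (Suc k)) (F k)"
    and adapted: "\<And>k. V k \<in> borel_measurable (F k)"
    and int_V: "\<And>k. integrable M (V k)" and nonneg_V: "\<And>k \<omega>. \<omega> \<in> space M \<Longrightarrow> 0 \<le> V k \<omega>"
    and int_W: "\<And>k. integrable M (W k)" and nonneg_W: "\<And>k \<omega>. \<omega> \<in> space M \<Longrightarrow> 0 \<le> W k \<omega>"
    and descent: "\<And>k A. A \<in> sets (F k) \<Longrightarrow>
      (\<integral>\<omega>. indicator A \<omega> * V (Suc k) \<omega> \<partial>M) \<le> (\<integral>\<omega>. indicator A \<omega> * (V k \<omega> - W k \<omega>) \<partial>M)"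
  shows "AE \<omega> in M. convergent (\<lambda>k. V k \<omega>)"
    and "summable (\<lambda>k. integral\<^sup>L M (W k))"
    and "AE \<omega> in M. summable (\<lambda>k. W k \<omega>)"
proof -
  have int_ind: "integrable M (\<lambda>\<omega>. indicator A \<omega> * f \<omega>)" if "integrable M f" "A \<in> sets (F k)"
    for A k and f :: "'a \<Rightarrow> real"
    using integrable_mult_indicator[of A M f] that sub[of k] by (auto simp: subalgebra_def)
  show "AE \<omega> in M. convergent (\<lambda>k. V k \<omega>)"
  proof (rule nonneg_supermartingale_converges[where F = F])
    fix k A assume A: "A \<in> sets (F k)"
    have "(\<integral>\<omega>. indicator A \<omega> * (V k \<omega> - W k \<omega>) \<partial>M) \<le> (\<integral>\<omega>. indicator A \<omega> * V k \<omega> \<partial>M)"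
      using A int_V int_W nonneg_W
      by (intro integral_mono int_ind[of _ A k] Bochner_Integration.integrable_diff)
        (auto simp: indicator_def)
    then show "(\<integral>\<omega>. indicator A \<omega> * V (Suc k) \<omega> \<partial>M) \<le> (\<integral>\<omega>. indicator A \<omega> * V k \<omega> \<partial>M)"
      using descent[OF A] by linarith
  qed (use sub mono adapted int_V nonneg_V in auto)
  have drop: "integral\<^sup>L M (V (Suc k)) \<le> integral\<^sup>L M (V k) - integral\<^sup>L M (W k)" for k
  proof -
    have "space M \<in> sets (F k)" using sub[of k] sets.top[of "F k"] by (simp add: subalgebra_def)
    from descent[OF this] have "integral\<^sup>L M (V (Suc k)) \<le> (\<integral>\<omega>. V k \<omega> - W k \<omega> \<partial>M)"
      by (simp cong: Bochner_Integration.integral_cong)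
    then show ?thesis using int_V int_W by simp
  qed
  have "(\<Sum>j<k. integral\<^sup>L M (W j)) \<le> integral\<^sup>L M (V 0)" for k
  proof -
    have "(\<Sum>j<k. integral\<^sup>L M (W j)) \<le> integral\<^sup>L M (V 0) - integral\<^sup>L M (V k)"
    proof (induction k)
      case (Suc k)
      then show ?case using drop[of k] by simp
    qed simp
    moreover have "0 \<le> integral\<^sup>L M (V k)"
      by (intro integral_nonneg_AE AE_I2 nonneg_V)
    ultimately show ?thesis by linarith
  qed
  then show summ: "summable (\<lambda>k. integral\<^sup>L M (W k))"
    by (intro summableI_nonneg_bounded[where x = "integral\<^sup>L M (V 0)"] integral_nonneg_AE AE_I2 nonneg_W)
  show "AE \<omega> in M. summable (\<lambda>k. W k \<omega>)"
    by (rule AE_summable_of_summable_integrals[OF int_W nonneg_W summ])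
qed

end

section \<open>The energy along one step\<close>

text \<open>
The two parts of the energy at a point \<open>p\<close>: here \<open>X\<close> stands for \<open>x\<^sup>k - p\<close>, \<open>v\<close> for \<open>x\<^sup>k - x\<^sup>k\<^sup>-\<^sup>1\<close> and
\<open>g\<close> for the operator at the previous iterate \<open>x\<^sup>k\<^sup>-\<^sup>1\<close>. Using the previous operator value makes the
energy after a step a quadratic function of the error, whatever the operator is.
\<close>

definition energy_lin :: "real \<Rightarrow> real \<Rightarrow> real \<Rightarrow> 'b::real_inner \<Rightarrow> 'b \<Rightarrow> 'b \<Rightarrow> real" where
  "energy_lin r \<beta> k X v g = (r + 1) * (norm X)\<^sup>2 + 2 * k * (X \<bullet> (v + (2 * \<beta>) *\<^sub>R g))"

definition energy_quad :: "real \<Rightarrow> real \<Rightarrow> 'b::real_inner \<Rightarrow> 'b \<Rightarrow> real" where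
  "energy_quad \<beta> k v g = k\<^sup>2 * ((norm (v + \<beta> *\<^sub>R g))\<^sup>2 + \<beta>\<^sup>2 * (norm g)\<^sup>2)"

definition energy :: "real \<Rightarrow> real \<Rightarrow> real \<Rightarrow> real \<Rightarrow> 'b::real_inner \<Rightarrow> 'b \<Rightarrow> 'b \<Rightarrow> real" where
  "energy r \<beta> s k X v g = s * energy_lin r \<beta> k X v g + energy_quad \<beta> k v g"

text \<open>
The vector \<open>m\<close> is the step \<open>x\<^sup>k\<^sup>+\<^sup>1 - x\<^sup>k\<close> that would be made with the exact direction, \<open>c *\<^sub>R n\<close> the
perturbation of it by the error, and \<open>g\<close>, \<open>h\<close> are the operator at \<open>x\<^sup>k\<close> and \<open>x\<^sup>k\<^sup>-\<^sup>1\<close>. For the linear part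
of the energy the identity holds because \<open>k (v + 2\<beta>h)\<close> is turned by the step into
\<open>(k + 1) (v' + 2\<beta>g)\<close> up to multiples of \<open>v'\<close>, \<open>g\<close> and \<open>n\<close>; for the quadratic part because
\<open>k (v + \<beta>h) - k\<beta>(g - h)\<close> differs from \<open>(k + 1) (m + \<beta>g)\<close> only by a bounded combination of \<open>m\<close> and \<open>g\<close>.
\<close>

lemma energy_step_identity:
  fixes X v g h m n :: "'b::real_inner" and c :: real
  assumes m: "(k + r + 2) *\<^sub>R m = k *\<^sub>R v - (2 * \<beta> * (k + r)) *\<^sub>R g + (2 * \<beta> * k) *\<^sub>R h"
  defines "v' \<equiv> m - c *\<^sub>R n"
  assumes c: "c * (k + r + 2) = 1"
  shows "energy r \<beta> s (k + 1) (X + v') v' g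
    = energy r \<beta> s k X v h
      - 2 * \<beta> * k\<^sup>2 * (v \<bullet> (g - h)) + 2 * \<beta>\<^sup>2 * k\<^sup>2 * (norm (g - h))\<^sup>2
      - 2 * (k + 1) * ((r + 1 - s) * (norm m)\<^sup>2 + (3 * r - 2 * s) * \<beta> * (m \<bullet> g) + (2 * r - 2) * \<beta>\<^sup>2 * (norm g)\<^sup>2)
      + s * (r + 1) * (norm m)\<^sup>2
      - 4 * \<beta> * s * (r - 1) * (X \<bullet> g)
      - \<beta>\<^sup>2 * (norm g)\<^sup>2
      - (norm ((r + 1) *\<^sub>R m + ((2 * r - 1) * \<beta>) *\<^sub>R g))\<^sup>2
      + c\<^sup>2 * ((k + 1)\<^sup>2 + s * (2 * k + r + 3)) * (norm n)\<^sup>2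
      - 2 * ((s *\<^sub>R (X + (c * (2 * k + r + 3)) *\<^sub>R m + (2 * \<beta> * (k + 1) * c) *\<^sub>R g)
             + ((k + 1)\<^sup>2 * c) *\<^sub>R (m + \<beta> *\<^sub>R g)) \<bullet> n)"
proof -
  define d where "d = c *\<^sub>R n"
  have n: "n = (k + r + 2) *\<^sub>R d" unfolding d_def scaleR_scaleR mult.commute[of _ c] c by simp
  have kv: "k *\<^sub>R v = (k + r + 2) *\<^sub>R m + (2 * \<beta> * (k + r)) *\<^sub>R g - (2 * \<beta> * k) *\<^sub>R h"
    unfolding m by simp
  have lin: "energy_lin r \<beta> (k + 1) (X + (m - d)) (m - d) g
    = energy_lin r \<beta> k X v h + (2 * k + r + 3) * (norm m)\<^sup>2
      + 4 * \<beta> * (k + 1) * (m \<bullet> g) - 4 * \<beta> * (r - 1) * (X \<bullet> g)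
      + (2 * k + r + 3) * (norm d)\<^sup>2
      - 2 * (((k + r + 2) *\<^sub>R X + (2 * k + r + 3) *\<^sub>R m + (2 * \<beta> * (k + 1)) *\<^sub>R g) \<bullet> d)"
  proof -
    \<comment> \<open>The three vectors of the linear part: the perturbed step, \<open>k (v + 2\<beta>h)\<close>, and the combination
        of \<open>g\<close> and the error by which, apart from a multiple of \<open>w\<close>, the step changes it.\<close>
    define w y q where "w = m - d" and "y = k *\<^sub>R v + (2 * \<beta> * k) *\<^sub>R h"
      and "q = (2 * \<beta> * (r - 1)) *\<^sub>R g + (k + r + 2) *\<^sub>R d"
    have y': "(k + 1) *\<^sub>R w + (2 * \<beta> * (k + 1)) *\<^sub>R g = y - (r + 1) *\<^sub>R w - q"
      unfolding y_def kv w_def q_def by (simp add: algebra_simps scaleR_2)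
    have "(r + 1) * (norm (X + w))\<^sup>2 + 2 * ((X + w) \<bullet> (y - (r + 1) *\<^sub>R w - q))
      = (r + 1) * (norm X)\<^sup>2 + 2 * (X \<bullet> y) - 2 * (X \<bullet> q) + (r + 1) * (norm w)\<^sup>2
        + 2 * (w \<bullet> (y - (r + 1) *\<^sub>R w - q))"
      by (simp add: power2_norm_eq_inner inner_simps inner_commute[of w X] algebra_simps)
    moreover have "energy_lin r \<beta> (k + 1) (X + w) w g = (r + 1) * (norm (X + w))\<^sup>2
        + 2 * ((X + w) \<bullet> ((k + 1) *\<^sub>R w + (2 * \<beta> * (k + 1)) *\<^sub>R g))"
      by (simp add: energy_lin_def inner_add_right algebra_simps)
    moreover have "energy_lin r \<beta> k X v h = (r + 1) * (norm X)\<^sup>2 + 2 * (X \<bullet> y)"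
      by (simp add: energy_lin_def y_def inner_add_right algebra_simps)
    moreover have "w \<bullet> ((k + 1) *\<^sub>R w + (2 * \<beta> * (k + 1)) *\<^sub>R g)
        = (k + 1) * (norm w)\<^sup>2 + 2 * \<beta> * (k + 1) * (w \<bullet> g)"
      by (simp add: inner_add_right power2_norm_eq_inner)
    moreover have "X \<bullet> q = 2 * \<beta> * (r - 1) * (X \<bullet> g) + (k + r + 2) * (X \<bullet> d)"
      by (simp add: q_def inner_add_right)
    moreover have "(norm w)\<^sup>2 = (norm m)\<^sup>2 - 2 * (m \<bullet> d) + (norm d)\<^sup>2"
      by (simp add: w_def power2_norm_eq_inner inner_simps inner_commute[of d m])
    moreover have "w \<bullet> g = m \<bullet> g - d \<bullet> g"
      by (simp add: w_def inner_simps)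
    ultimately show ?thesis
      unfolding w_def[symmetric] y'[symmetric]
      by (simp add: inner_add_left inner_commute[of g d] algebra_simps)
  qed
  have quad: "energy_quad \<beta> (k + 1) (m - d) g
    = energy_quad \<beta> k v h
      - 2 * \<beta> * k\<^sup>2 * (v \<bullet> (g - h)) + 2 * \<beta>\<^sup>2 * k\<^sup>2 * (norm (g - h))\<^sup>2
      - 2 * (k + 1) * ((r + 1) * (norm m)\<^sup>2 + 3 * r * \<beta> * (m \<bullet> g) + (2 * r - 2) * \<beta>\<^sup>2 * (norm g)\<^sup>2)
      - \<beta>\<^sup>2 * (norm g)\<^sup>2
      - (norm ((r + 1) *\<^sub>R m + ((2 * r - 1) * \<beta>) *\<^sub>R g))\<^sup>2
      + (k + 1)\<^sup>2 * (norm d)\<^sup>2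
      - 2 * (k + 1)\<^sup>2 * ((m + \<beta> *\<^sub>R g) \<bullet> d)"
  proof -
    \<comment> \<open>Here \<open>f\<close> is the bounded remainder that separates the two scaled vectors of the quadratic part.\<close>
    define b f where "b = m + \<beta> *\<^sub>R g" and "f = (r + 1) *\<^sub>R m + ((2 * r - 1) * \<beta>) *\<^sub>R g"
    define q where "q = g - h"
    have bf: "k *\<^sub>R v + (k * \<beta>) *\<^sub>R h - (k * \<beta>) *\<^sub>R q = (k + 1) *\<^sub>R b + f"
    proof -
      have "A *\<^sub>R m + B *\<^sub>R g - C *\<^sub>R h + E *\<^sub>R h - E *\<^sub>R (g - h)
          = A *\<^sub>R m + (B - E) *\<^sub>R g + (E + E - C) *\<^sub>R h" for A B C E
        by (simp only: scaleR_left_distrib scaleR_left_diff_distrib scaleR_right_diff_distrib) simp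
      moreover have "(k + 1) *\<^sub>R (m + \<beta> *\<^sub>R g) + ((r + 1) *\<^sub>R m + E *\<^sub>R g)
          = (k + 1 + (r + 1)) *\<^sub>R m + ((k + 1) * \<beta> + E) *\<^sub>R g + 0 *\<^sub>R h" for E
        by (simp add: algebra_simps scaleR_2)
      moreover have "k + r + 2 = k + 1 + (r + 1)" "k * \<beta> + k * \<beta> - 2 * \<beta> * k = 0"
        "2 * \<beta> * (k + r) - k * \<beta> = (k + 1) * \<beta> + (2 * r - 1) * \<beta>"
        by (simp_all add: algebra_simps)
      ultimately show ?thesis
        unfolding kv b_def f_def q_def by (simp only:)
    qed
    have gq: "h + q = g" by (simp add: q_def)
    have e1: "k\<^sup>2 * ((norm (v + \<beta> *\<^sub>R h - \<beta> *\<^sub>R q))\<^sup>2 + \<beta>\<^sup>2 * (norm g)\<^sup>2)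
      = k\<^sup>2 * ((norm (v + \<beta> *\<^sub>R h))\<^sup>2 + \<beta>\<^sup>2 * (norm h)\<^sup>2
        - 2 * \<beta> * (v \<bullet> q) + 2 * \<beta>\<^sup>2 * (norm q)\<^sup>2)"
      unfolding power2_norm_eq_inner gq[symmetric]
      by (simp add: inner_simps inner_commute[of q v] inner_commute[of h v]
          inner_commute[of q h] power2_eq_square algebra_simps)
    have e2: "k\<^sup>2 * (norm (v + \<beta> *\<^sub>R h - \<beta> *\<^sub>R q))\<^sup>2 = (norm ((k + 1) *\<^sub>R b + f))\<^sup>2"
    proof -
      have "k *\<^sub>R (v + \<beta> *\<^sub>R h - \<beta> *\<^sub>R q) = (k + 1) *\<^sub>R b + f"
        using bf by (simp add: scaleR_right_distrib scaleR_right_diff_distrib)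
      then show ?thesis by (metis norm_scaleR power2_abs power_mult_distrib)
    qed
    have e3: "(norm ((k + 1) *\<^sub>R b + f))\<^sup>2
        = (k + 1)\<^sup>2 * (norm b)\<^sup>2 + 2 * (k + 1) * (b \<bullet> f) + (norm f)\<^sup>2"
      unfolding power2_norm_eq_inner
      by (simp add: inner_simps inner_commute[of f b] power2_eq_square algebra_simps)
    have e4: "b \<bullet> f = (r + 1) * (norm m)\<^sup>2 + 3 * r * \<beta> * (m \<bullet> g) + (2 * r - 1) * \<beta>\<^sup>2 * (norm g)\<^sup>2"
      unfolding power2_norm_eq_inner
      by (simp add: b_def f_def inner_simps inner_commute[of g m] power2_eq_square algebra_simps)
    have e5: "(norm (m - d + \<beta> *\<^sub>R g))\<^sup>2 = (norm b)\<^sup>2 - 2 * (b \<bullet> d) + (norm d)\<^sup>2"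
    proof -
      have "m - d + \<beta> *\<^sub>R g = b - d" by (simp add: b_def)
      then show ?thesis
        by (simp only: power2_norm_eq_inner inner_diff_left inner_diff_right inner_commute[of d b])
    qed
    show ?thesis
      unfolding energy_quad_def e5 b_def[symmetric] f_def[symmetric] q_def[symmetric]
      using e1 e2 e3 unfolding e4 by (simp add: power2_sum algebra_simps)
  qed
  define a1 a2 a3 where "a1 = ((k + r + 2) *\<^sub>R X + (2 * k + r + 3) *\<^sub>R m + (2 * \<beta> * (k + 1)) *\<^sub>R g) \<bullet> d"
    and "a2 = (m + \<beta> *\<^sub>R g) \<bullet> d"
    and "a3 = (norm ((r + 1) *\<^sub>R m + ((2 * r - 1) * \<beta>) *\<^sub>R g))\<^sup>2"
  have noise_sq: "c\<^sup>2 * w * (norm n)\<^sup>2 = w * (norm d)\<^sup>2" for w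
    by (simp add: d_def power_mult_distrib)
  have noise_lin: "(s *\<^sub>R (X + (c * (2 * k + r + 3)) *\<^sub>R m + (2 * \<beta> * (k + 1) * c) *\<^sub>R g)
             + ((k + 1)\<^sup>2 * c) *\<^sub>R (m + \<beta> *\<^sub>R g)) \<bullet> n = s * a1 + (k + 1)\<^sup>2 * a2"
  proof -
    have "(a * c) * (y \<bullet> n) = a * (y \<bullet> d)" "(c * a) * (y \<bullet> n) = a * (y \<bullet> d)" for y a
      by (simp_all add: d_def)
    moreover have "X \<bullet> n = (k + r + 2) * (X \<bullet> d)"
      using n by (metis inner_scaleR_right)
    ultimately show ?thesis
      unfolding a1_def a2_def inner_add_left inner_scaleR_left distrib_left[of "(k + 1)\<^sup>2 * c"]
        distrib_left[of "(k + 1)\<^sup>2"] mult.left_commute[of _ \<beta>] by (simp only:)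
  qed
  show ?thesis
    unfolding noise_sq noise_lin energy_def v'_def d_def[symmetric] lin[folded a1_def]
      quad[folded a2_def a3_def] a3_def[symmetric]
    by (simp add: field_simps)
qed

text \<open>
The scalar discriminant criterion carries over to vectors by completing the square. The constant is
chosen such that \<open>(A - \<epsilon>) (C - \<epsilon>) - B\<^sup>2 / 4 = \<epsilon>\<^sup>2\<close>, so that the form remains nonnegative when \<open>\<epsilon>\<close> is
subtracted from both diagonal coefficients.
\<close>

lemma posdef_quadratic_form:
  fixes A B C :: real
  assumes "0 < A" "0 < C" "B\<^sup>2 < 4 * A * C"
  obtains \<epsilon> where "0 < \<epsilon>"
    "\<And>m g :: 'b::real_inner. \<epsilon> * ((norm m)\<^sup>2 + (norm g)\<^sup>2) \<le> A * (norm m)\<^sup>2 + B * (m \<bullet> g) + C * (norm g)\<^sup>2"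
proof
  define \<epsilon> where "\<epsilon> = (4 * A * C - B\<^sup>2) / (4 * (A + C))"
  show pos: "0 < \<epsilon>" unfolding \<epsilon>_def using assms by simp
  have "\<epsilon> * (A + C) = (4 * A * C - B\<^sup>2) / 4" unfolding \<epsilon>_def using assms by (simp add: field_simps)
  then have disc: "B\<^sup>2 \<le> 4 * (A - \<epsilon>) * (C - \<epsilon>)"
    using pos by (simp add: algebra_simps)
  have "\<epsilon> * (A + C) < A * (A + C)"
  proof -
    have "(4 * A * C - B\<^sup>2) / 4 \<le> A * C" by simp
    also have "\<dots> < A * (A + C)" using assms by simp
    finally show ?thesis using \<open>\<epsilon> * (A + C) = _\<close> by simp
  qed
  then have A: "0 < A - \<epsilon>" using assms by simp
  fix m g :: 'b
  have "4 * (A - \<epsilon>) * ((A - \<epsilon>) * (m \<bullet> m) + B * (m \<bullet> g) + (C - \<epsilon>) * (g \<bullet> g))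
      = ((2 * (A - \<epsilon>)) *\<^sub>R m + B *\<^sub>R g) \<bullet> ((2 * (A - \<epsilon>)) *\<^sub>R m + B *\<^sub>R g)
        + (4 * (A - \<epsilon>) * (C - \<epsilon>) - B\<^sup>2) * (g \<bullet> g)"
    by (simp only: inner_add_left inner_add_right inner_scaleR_left inner_scaleR_right inner_commute[of g m]) algebra
  also have "\<dots> \<ge> 0" using disc by (intro add_nonneg_nonneg mult_nonneg_nonneg) auto
  finally have "0 \<le> (A - \<epsilon>) * (m \<bullet> m) + B * (m \<bullet> g) + (C - \<epsilon>) * (g \<bullet> g)"
    using A by (simp add: zero_le_mult_iff)
  then show "\<epsilon> * ((norm m)\<^sup>2 + (norm g)\<^sup>2) \<le> A * (norm m)\<^sup>2 + B * (m \<bullet> g) + C * (norm g)\<^sup>2"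
    by (simp add: power2_norm_eq_inner algebra_simps)
qed

text \<open>
The vector that the scaled error \<open>n\<close> is paired with in \<open>energy_step_identity\<close>. It depends only on
quantities known before the error is drawn.
\<close>

definition noise_dir :: "real \<Rightarrow> real \<Rightarrow> real \<Rightarrow> real \<Rightarrow> 'b::real_inner \<Rightarrow> 'b \<Rightarrow> 'b \<Rightarrow> 'b" where
  "noise_dir r \<beta> s k X m g =
     (let c = 1 / (k + r + 2) in
      s *\<^sub>R (X + (c * (2 * k + r + 3)) *\<^sub>R m + (2 * \<beta> * (k + 1) * c) *\<^sub>R g)
      + ((k + 1)\<^sup>2 * c) *\<^sub>R (m + \<beta> *\<^sub>R g))"

text \<open>
In the identity the form in \<open>m\<close> and \<open>g\<close> has discriminant proportional to \<open>(r - 2s)\<^sup>2 - 8 (s - 1)\<close>, hence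
is positive definite. Its factor \<open>2 (k + 1)\<close> eventually absorbs the constant multiple of \<open>|m|\<^sup>2\<close>, using up
half of it, while the coefficient of \<open>|n|\<^sup>2\<close> tends to 1 and thus drops below \<open>\<kappa>\<close>.
\<close>

lemma energy_descent:
  fixes r \<beta> s L \<kappa> :: real
  assumes "2 < r" "0 < \<beta>" "s < r + 1" and s: "(r - 2 * s)\<^sup>2 < 8 * (s - 1)" and "1 < \<kappa>"
  obtains \<epsilon> where "0 < \<epsilon>"
    "\<forall>\<^sub>F k in sequentially. \<forall>(X::'b::real_inner) v g h m n U.
       (real k + r + 2) *\<^sub>R m = real k *\<^sub>R v - (2 * \<beta> * (real k + r)) *\<^sub>R g + (2 * \<beta> * real k) *\<^sub>R h \<longrightarrow>
       0 \<le> X \<bullet> g \<longrightarrow> U / L \<le> v \<bullet> (g - h) \<longrightarrow> (norm (g - h))\<^sup>2 \<le> U \<longrightarrow>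
       energy r \<beta> s (real k + 1) (X + (m - (1 / (real k + r + 2)) *\<^sub>R n)) (m - (1 / (real k + r + 2)) *\<^sub>R n) g
       \<le> energy r \<beta> s (real k) X v h - 2 * \<beta> * (1 / L - \<beta>) * (real k)\<^sup>2 * U
          - \<epsilon> * (real k + 1) * ((norm m)\<^sup>2 + (norm g)\<^sup>2)
          + \<kappa> * (norm n)\<^sup>2 - 2 * (noise_dir r \<beta> s (real k) X m g \<bullet> n)"
proof -
  have "0 < 8 * (s - 1)" using s by (rule le_less_trans[rotated]) simp
  then have s1: "1 < s" by simp
  have disc: "((3 * r - 2 * s) * \<beta>)\<^sup>2 < 4 * (r + 1 - s) * ((2 * r - 2) * \<beta>\<^sup>2)"
  proof -
    have "(3 * r - 2 * s)\<^sup>2 < 4 * (r + 1 - s) * (2 * r - 2)"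
      using s by (simp add: power2_eq_square algebra_simps)
    then have "(3 * r - 2 * s)\<^sup>2 * \<beta>\<^sup>2 < 4 * (r + 1 - s) * (2 * r - 2) * \<beta>\<^sup>2"
      using assms by simp
    then show ?thesis by (simp add: power_mult_distrib mult.assoc)
  qed
  obtain e where e: "0 < e" "\<And>m g :: 'b. e * ((norm m)\<^sup>2 + (norm g)\<^sup>2) \<le>
      (r + 1 - s) * (norm m)\<^sup>2 + ((3 * r - 2 * s) * \<beta>) * (m \<bullet> g) + ((2 * r - 2) * \<beta>\<^sup>2) * (norm g)\<^sup>2"
    using posdef_quadratic_form[OF _ _ disc, where 'b = 'b] assms by auto
  show ?thesis
  proof
    show "0 < e" by (rule e)
    have "((\<lambda>k. (1 / (real k + r + 2))\<^sup>2 * ((real k + 1)\<^sup>2 + s * (2 * real k + r + 3))) \<longlongrightarrow> 1) sequentially"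
      by real_asymp
    then have "\<forall>\<^sub>F k in sequentially. (1 / (real k + r + 2))\<^sup>2 * ((real k + 1)\<^sup>2 + s * (2 * real k + r + 3)) < \<kappa>"
      by (rule order_tendstoD) (rule assms)
    moreover have "\<forall>\<^sub>F k in sequentially. s * (r + 1) / e < real k + 1"
      by real_asymp
    ultimately show "\<forall>\<^sub>F k in sequentially. \<forall>(X::'b::real_inner) v g h m n U.
       (real k + r + 2) *\<^sub>R m = real k *\<^sub>R v - (2 * \<beta> * (real k + r)) *\<^sub>R g + (2 * \<beta> * real k) *\<^sub>R h \<longrightarrow>
       0 \<le> X \<bullet> g \<longrightarrow> U / L \<le> v \<bullet> (g - h) \<longrightarrow> (norm (g - h))\<^sup>2 \<le> U \<longrightarrow>
       energy r \<beta> s (real k + 1) (X + (m - (1 / (real k + r + 2)) *\<^sub>R n)) (m - (1 / (real k + r + 2)) *\<^sub>R n) g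
       \<le> energy r \<beta> s (real k) X v h - 2 * \<beta> * (1 / L - \<beta>) * (real k)\<^sup>2 * U
          - e * (real k + 1) * ((norm m)\<^sup>2 + (norm g)\<^sup>2)
          + \<kappa> * (norm n)\<^sup>2 - 2 * (noise_dir r \<beta> s (real k) X m g \<bullet> n)"
    proof (eventually_elim, intro allI impI)
      fix k :: nat and X v g h m n :: 'b and U :: real
      let ?k = "real k" and ?c = "1 / (real k + r + 2)"
      assume \<kappa>: "?c\<^sup>2 * ((?k + 1)\<^sup>2 + s * (2 * ?k + r + 3)) < \<kappa>"
        and big: "s * (r + 1) / e < ?k + 1"
        and m: "(?k + r + 2) *\<^sub>R m = ?k *\<^sub>R v - (2 * \<beta> * (?k + r)) *\<^sub>R g + (2 * \<beta> * ?k) *\<^sub>R h"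
        and Xg: "0 \<le> X \<bullet> g" and mono: "U / L \<le> v \<bullet> (g - h)" and lip: "(norm (g - h))\<^sup>2 \<le> U"
      have k: "0 < ?k + r + 2" using assms by simp
      then have c: "?c * (?k + r + 2) = 1" by simp
      \<comment> \<open>A purely linear statement; the terms are matched with those of the identity in order.\<close>
      have combine: "E - T1 + T2 - T3 + T4 - T5 - T6 - T7 + T8 - N \<le> E - (A - B) - T + K - N"
        if "A \<le> T1" "T2 \<le> B" "2 * T \<le> T3" "T4 \<le> T" "0 \<le> T5" "0 \<le> T6" "0 \<le> T7" "T8 \<le> K"
        for E T1 T2 T3 T4 T5 T6 T7 T8 N A B T K :: real
        using that by linarith
      have U: "2 * \<beta> * (1 / L - \<beta>) * ?k\<^sup>2 * U = 2 * \<beta> * ?k\<^sup>2 * (U / L) - 2 * \<beta>\<^sup>2 * ?k\<^sup>2 * U"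
        by (simp add: power2_eq_square algebra_simps)
      show "energy r \<beta> s (?k + 1) (X + (m - ?c *\<^sub>R n)) (m - ?c *\<^sub>R n) g
         \<le> energy r \<beta> s ?k X v h - 2 * \<beta> * (1 / L - \<beta>) * ?k\<^sup>2 * U
          - e * (?k + 1) * ((norm m)\<^sup>2 + (norm g)\<^sup>2)
          + \<kappa> * (norm n)\<^sup>2 - 2 * (noise_dir r \<beta> s ?k X m g \<bullet> n)"
        unfolding energy_step_identity[OF m c] noise_dir_def Let_def U
      proof (rule combine)
        show "2 * \<beta> * ?k\<^sup>2 * (U / L) \<le> 2 * \<beta> * ?k\<^sup>2 * (v \<bullet> (g - h))"
          using mono assms by (intro mult_left_mono) auto
        show "2 * \<beta>\<^sup>2 * ?k\<^sup>2 * (norm (g - h))\<^sup>2 \<le> 2 * \<beta>\<^sup>2 * ?k\<^sup>2 * U"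
          using lip by (intro mult_left_mono) auto
        have "2 * (?k + 1) * (e * ((norm m)\<^sup>2 + (norm g)\<^sup>2)) \<le> 2 * (?k + 1) *
          ((r + 1 - s) * (norm m)\<^sup>2 + (3 * r - 2 * s) * \<beta> * (m \<bullet> g) + (2 * r - 2) * \<beta>\<^sup>2 * (norm g)\<^sup>2)"
          by (intro mult_left_mono e) auto
        then show "2 * (e * (?k + 1) * ((norm m)\<^sup>2 + (norm g)\<^sup>2)) \<le> 2 * (?k + 1) *
          ((r + 1 - s) * (norm m)\<^sup>2 + (3 * r - 2 * s) * \<beta> * (m \<bullet> g) + (2 * r - 2) * \<beta>\<^sup>2 * (norm g)\<^sup>2)"
          by (simp only: mult_ac)
        show "s * (r + 1) * (norm m)\<^sup>2 \<le> e * (?k + 1) * ((norm m)\<^sup>2 + (norm g)\<^sup>2)"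
        proof (rule mult_mono)
          show "s * (r + 1) \<le> e * (?k + 1)" using big e(1) by (simp add: pos_divide_less_eq mult.commute)
        qed (use e(1) in auto)
        show "0 \<le> 4 * \<beta> * s * (r - 1) * (X \<bullet> g)"
          using assms s1 Xg by (intro mult_nonneg_nonneg) auto
        show "?c\<^sup>2 * ((?k + 1)\<^sup>2 + s * (2 * ?k + r + 3)) * (norm n)\<^sup>2 \<le> \<kappa> * (norm n)\<^sup>2"
          using \<kappa> by (intro mult_right_mono) auto
      qed auto
    qed
  qed
qed

text \<open>
Completing the square, the energy is \<open>|s X + k (v + \<beta>g)|\<^sup>2 + s (r + 1 - s) |X|\<^sup>2 + \<beta>\<^sup>2 k\<^sup>2 |g|\<^sup>2\<close> plus
\<open>2 s \<beta> k \<langle>X, g\<rangle>\<close>. As \<open>g\<close> belongs to the previous iterate, monotonicity only gives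
\<open>\<langle>X, g\<rangle> \<ge> \<langle>v, g\<rangle>\<close>; but \<open>k \<langle>v, g\<rangle>\<close> is \<open>1 / k\<close> times a form in \<open>k v\<close> and \<open>k g\<close>, and the squares dominate it
for large \<open>k\<close>.
\<close>

lemma energy_nonneg:
  fixes r \<beta> s :: real
  assumes "0 < \<beta>" "0 < s" "s < r + 1"
  shows "\<forall>\<^sub>F k in sequentially. \<forall>(X::'b::real_inner) v g.
     0 \<le> (X - v) \<bullet> g \<longrightarrow> 0 \<le> energy r \<beta> s (real k) X v g"
proof -
  have "\<forall>\<^sub>F k in sequentially. 2 * s * \<beta> / real k \<le> 1"
    "\<forall>\<^sub>F k in sequentially. 2 * s * \<beta> / real k * s\<^sup>2 \<le> s * (r + 1 - s)"
    "\<forall>\<^sub>F k in sequentially. 2 * s * \<beta> / real k * (1 / 2 + \<beta>) \<le> \<beta>\<^sup>2"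
  proof -
    have lim: "(\<lambda>k. 2 * s * \<beta> / real k) \<longlonglongrightarrow> 0" by real_asymp
    have ev: "\<forall>\<^sub>F k in sequentially. 2 * s * \<beta> / real k * C \<le> D" if "0 < D" for C D
      using order_tendstoD(2)[OF tendsto_mult_left_zero[OF lim, of C] that]
      by eventually_elim simp
    show "\<forall>\<^sub>F k in sequentially. 2 * s * \<beta> / real k \<le> 1" using ev[of 1 1] by simp
    show "\<forall>\<^sub>F k in sequentially. 2 * s * \<beta> / real k * s\<^sup>2 \<le> s * (r + 1 - s)"
      using assms by (intro ev) auto
    show "\<forall>\<^sub>F k in sequentially. 2 * s * \<beta> / real k * (1 / 2 + \<beta>) \<le> \<beta>\<^sup>2"
      using assms by (intro ev) auto
  qed
  then show ?thesis
    using eventually_gt_at_top[of 0]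
  proof (eventually_elim, intro allI impI)
    fix k :: nat and X v g :: 'b
    let ?q = "2 * s * \<beta> / real k"
    assume q: "?q \<le> 1" "?q * s\<^sup>2 \<le> s * (r + 1 - s)" "?q * (1 / 2 + \<beta>) \<le> \<beta>\<^sup>2" and k: "0 < k"
      and mono: "0 \<le> (X - v) \<bullet> g"
    define y h p where "y = real k *\<^sub>R (v + \<beta> *\<^sub>R g)" and "h = real k *\<^sub>R g" and "p = s *\<^sub>R X + y"
    have q0: "0 \<le> ?q" using assms k by simp
    have "(norm y)\<^sup>2 \<le> 2 * (norm p)\<^sup>2 + 2 * s\<^sup>2 * (norm X)\<^sup>2"
    proof -
      have "0 \<le> (norm (p + s *\<^sub>R X))\<^sup>2" by simp
      also have "\<dots> = 2 * (norm p)\<^sup>2 + 2 * s\<^sup>2 * (norm X)\<^sup>2 - (norm (p - s *\<^sub>R X))\<^sup>2"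
        unfolding power2_norm_eq_inner
        by (simp add: inner_simps power2_eq_square inner_commute[of X p] algebra_simps)
      also have "p - s *\<^sub>R X = y" by (simp add: p_def)
      finally show ?thesis by simp
    qed
    then have "?q / 2 * (norm y)\<^sup>2 \<le> ?q / 2 * (2 * (norm p)\<^sup>2 + 2 * s\<^sup>2 * (norm X)\<^sup>2)"
      using q0 by (intro mult_left_mono) auto
    also have "\<dots> = ?q * (norm p)\<^sup>2 + ?q * s\<^sup>2 * (norm X)\<^sup>2"
      by (simp add: algebra_simps)
    also have "\<dots> \<le> 1 * (norm p)\<^sup>2 + s * (r + 1 - s) * (norm X)\<^sup>2"
      using q by (intro add_mono mult_right_mono) auto
    finally have 1: "?q / 2 * (norm y)\<^sup>2 \<le> (norm p)\<^sup>2 + s * (r + 1 - s) * (norm X)\<^sup>2" by simp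
    have 2: "?q * (1 / 2 + \<beta>) * (norm h)\<^sup>2 \<le> \<beta>\<^sup>2 * (norm h)\<^sup>2"
      using q by (intro mult_right_mono) auto
    have "- (y \<bullet> h) \<le> norm y * norm h"
      using Cauchy_Schwarz_ineq2[of y h] by linarith
    also have "\<dots> \<le> (norm y)\<^sup>2 / 2 + (norm h)\<^sup>2 / 2"
      using sum_squares_bound[of "norm y" "norm h"] by simp
    finally have "?q * - (y \<bullet> h) \<le> ?q * ((norm y)\<^sup>2 / 2 + (norm h)\<^sup>2 / 2)"
      using q0 by (intro mult_left_mono)
    then have 3: "0 \<le> ?q * (y \<bullet> h) + ?q / 2 * (norm y)\<^sup>2 + ?q / 2 * (norm h)\<^sup>2"
      by (simp add: algebra_simps)
    have "2 * s * \<beta> * real k * (v \<bullet> g) = ?q * (y \<bullet> h) - ?q * \<beta> * (norm h)\<^sup>2"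
      using k unfolding y_def h_def power2_norm_eq_inner
      by (simp add: inner_add_left power2_eq_square field_simps)
    moreover have "2 * s * \<beta> * real k * (v \<bullet> g) \<le> 2 * s * \<beta> * real k * (X \<bullet> g)"
      using mono assms by (intro mult_left_mono) (auto simp: inner_diff_left)
    moreover have "energy r \<beta> s (real k) X v g =
        (norm p)\<^sup>2 + s * (r + 1 - s) * (norm X)\<^sup>2 + 2 * s * \<beta> * real k * (X \<bullet> g) + \<beta>\<^sup>2 * (norm h)\<^sup>2"
      unfolding energy_def energy_lin_def energy_quad_def p_def y_def h_def power2_norm_eq_inner
      by (simp add: inner_simps inner_commute[of v X] inner_commute[of g X] inner_commute[of g v] power2_eq_square algebra_simps)
    moreover have "?q * (1 / 2 + \<beta>) * (norm h)\<^sup>2 = ?q / 2 * (norm h)\<^sup>2 + ?q * \<beta> * (norm h)\<^sup>2"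
      by (simp add: distrib_left distrib_right)
    ultimately show "0 \<le> energy r \<beta> s (real k) X v g"
      using 1 2 3 by linarith
  qed
qed

section \<open>Sequences controlled by two energies\<close>

text \<open>
A positive limit would make the series dominate a multiple of the harmonic series.
\<close>

lemma tendsto_zero_if_convergent_summable_over_index:
  fixes q :: "nat \<Rightarrow> real"
  assumes "convergent q" "\<And>k. 0 \<le> q k" "summable (\<lambda>k. q (Suc k) / real (Suc k))"
  shows "q \<longlonglongrightarrow> 0"
proof -
  obtain l where l: "q \<longlonglongrightarrow> l" using assms by (auto simp: convergent_def)
  then have "0 \<le> l" using assms by (intro LIMSEQ_le_const[OF l]) auto
  moreover have False if "0 < l"
  proof -
    have "\<forall>\<^sub>F k in sequentially. l / 2 < q (Suc k)"
      using order_tendstoD(1)[OF LIMSEQ_Suc[OF l], of "l / 2"] that by simp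
    then have "\<forall>\<^sub>F k in sequentially. norm (l / 2 * (1 / real (Suc k))) \<le> q (Suc k) / real (Suc k)"
    proof eventually_elim
      case (elim k)
      then have "l / 2 / real (Suc k) \<le> q (Suc k) / real (Suc k)"
        by (intro divide_right_mono) auto
      then show ?case using that by simp
    qed
    then have "summable (\<lambda>k. l / 2 * (1 / real (Suc k)))"
      by (rule summable_comparison_test_ev) (rule assms)
    then have "summable (\<lambda>k. inverse (real (Suc k)))"
      using that by (subst (asm) summable_cmult_iff) (auto simp: inverse_eq_divide)
    then show False using not_summable_harmonic[where 'a = real] summable_Suc_iff[of "\<lambda>k. inverse (real k)"]
      by (simp add: inverse_eq_divide)
  qed
  ultimately show ?thesis using l by (cases "l = 0") auto
qed

text \<open>
The energy is affine in \<open>s\<close>, so two different values of \<open>s\<close> determine its two parts. The quadratic part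
tends to 0; the linear part is then \<open>(r + 1) |X|\<^sup>2\<close> up to the pairing of \<open>X\<close> with a null sequence, which
first bounds \<open>X\<close> and then disappears in the limit.
\<close>

lemma energies_control_sequence:
  fixes X v g :: "nat \<Rightarrow> 'b::real_inner"
  assumes "0 < \<beta>" "0 < r" "s1 \<noteq> s2"
    and conv: "convergent (\<lambda>k. energy r \<beta> s1 (real k) (X k) (v k) (g k))"
      "convergent (\<lambda>k. energy r \<beta> s2 (real k) (X k) (v k) (g k))"
    and summ: "summable (\<lambda>k. energy_quad \<beta> (real (Suc k)) (v (Suc k)) (g (Suc k)) / real (Suc k))"
  shows "(\<lambda>k. real k *\<^sub>R v k) \<longlonglongrightarrow> 0" "(\<lambda>k. real k *\<^sub>R g k) \<longlonglongrightarrow> 0"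
    and "convergent (\<lambda>k. norm (X k))"
proof -
  define P Q where "P k = energy_lin r \<beta> (real k) (X k) (v k) (g k)"
    and "Q k = energy_quad \<beta> (real k) (v k) (g k)" for k
  have P_diff: "P k = (1 / (s1 - s2)) * (energy r \<beta> s1 (real k) (X k) (v k) (g k) - energy r \<beta> s2 (real k) (X k) (v k) (g k))" for k
    using assms by (simp add: P_def energy_def left_diff_distrib[symmetric])
  have P: "convergent P"
    unfolding P_diff by (intro convergent_mult convergent_diff convergent_const conv)
  have Q_diff: "Q k = energy r \<beta> s1 (real k) (X k) (v k) (g k) - s1 * P k" for k
    by (simp add: P_def Q_def energy_def)
  have "convergent Q"
    unfolding Q_diff by (intro convergent_mult convergent_diff convergent_const conv P)
  then have Q0: "Q \<longlonglongrightarrow> 0"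
    using summ by (intro tendsto_zero_if_convergent_summable_over_index) (auto simp: Q_def energy_quad_def)
  have sq: "f \<longlonglongrightarrow> 0" if "\<And>k. (norm (f k))\<^sup>2 \<le> C * Q k" for f :: "nat \<Rightarrow> 'b" and C
  proof -
    have "(\<lambda>k. (norm (f k))\<^sup>2) \<longlonglongrightarrow> 0"
      by (rule tendsto_sandwich[OF _ _ tendsto_const tendsto_mult_right_zero[OF Q0, of C]])
        (auto intro: always_eventually that)
    then have "(\<lambda>k. sqrt ((norm (f k))\<^sup>2)) \<longlonglongrightarrow> sqrt 0" by (rule tendsto_real_sqrt)
    then show ?thesis by (simp add: tendsto_norm_zero_iff)
  qed
  have g0: "(\<lambda>k. real k *\<^sub>R g k) \<longlonglongrightarrow> 0"
    by (rule sq[of _ "1 / \<beta>\<^sup>2"]) (use assms in \<open>simp add: Q_def energy_quad_def power_mult_distrib field_simps\<close>)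
  moreover have w0: "(\<lambda>k. real k *\<^sub>R (v k + \<beta> *\<^sub>R g k)) \<longlonglongrightarrow> 0"
    by (rule sq[of _ 1]) (simp add: Q_def energy_quad_def power_mult_distrib distrib_left
      del: scaleR_right_distrib)
  ultimately have "(\<lambda>k. real k *\<^sub>R (v k + \<beta> *\<^sub>R g k) - \<beta> *\<^sub>R (real k *\<^sub>R g k)) \<longlonglongrightarrow> 0 - \<beta> *\<^sub>R 0"
    by (intro tendsto_intros)
  then show v0: "(\<lambda>k. real k *\<^sub>R v k) \<longlonglongrightarrow> 0" by (simp add: algebra_simps)
  show "(\<lambda>k. real k *\<^sub>R g k) \<longlonglongrightarrow> 0" by (rule g0)
  define u where "u k = real k *\<^sub>R v k + (2 * \<beta>) *\<^sub>R (real k *\<^sub>R g k)" for k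
  have "u \<longlonglongrightarrow> 0 + (2 * \<beta>) *\<^sub>R 0" unfolding u_def using v0 g0 by (intro tendsto_intros)
  then have u0: "u \<longlonglongrightarrow> 0" by simp
  have P_eq: "P k = (r + 1) * (norm (X k))\<^sup>2 + 2 * (X k \<bullet> u k)" for k
    by (simp add: P_def energy_lin_def u_def inner_add_right algebra_simps)
  have bdd: "Bseq X"
  proof -
    obtain A where A: "\<And>k. \<bar>P k\<bar> \<le> A" using convergent_imp_Bseq[OF P] by (auto simp: Bseq_def)
    obtain B where B: "\<And>k. norm (u k) \<le> B" using convergent_imp_Bseq[OF convergentI[OF u0]] by (auto simp: Bseq_def)
    have "norm (X k) \<le> sqrt ((A + B\<^sup>2) / r)" for k
    proof (rule real_le_rsqrt)
      have "- (X k \<bullet> u k) \<le> norm (X k) * norm (u k)"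
        using Cauchy_Schwarz_ineq2[of "X k" "u k"] by linarith
      moreover have "2 * norm (X k) * norm (u k) \<le> (norm (X k))\<^sup>2 + (norm (u k))\<^sup>2"
        by (rule sum_squares_bound)
      moreover have "(norm (u k))\<^sup>2 \<le> B\<^sup>2" using B by (intro power_mono) auto
      moreover have "P k \<le> A" using A[of k] by simp
      ultimately have "r * (norm (X k))\<^sup>2 \<le> A + B\<^sup>2"
        using P_eq[of k] by (simp add: algebra_simps)
      then show "(norm (X k))\<^sup>2 \<le> (A + B\<^sup>2) / r" using assms by (simp add: field_simps)
    qed
    then show ?thesis by (rule BseqI')
  qed
  have "(\<lambda>k. X k \<bullet> u k) \<longlonglongrightarrow> 0"
    using bounded_bilinear.Bfun_prod_Zfun[OF bounded_bilinear_inner, of X sequentially u] bdd u0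
    by (simp add: tendsto_Zfun_iff)
  then have "convergent (\<lambda>k. X k \<bullet> u k)" by (rule convergentI)
  moreover have norm_eq: "(norm (X k))\<^sup>2 = (1 / (r + 1)) * (P k - 2 * (X k \<bullet> u k))" for k
    using assms by (simp add: P_eq)
  ultimately have "convergent (\<lambda>k. (norm (X k))\<^sup>2)"
    unfolding norm_eq by (intro convergent_mult convergent_diff convergent_const P)
  then obtain l where "(\<lambda>k. (norm (X k))\<^sup>2) \<longlonglongrightarrow> l" by (auto simp: convergent_def)
  then have "(\<lambda>k. sqrt ((norm (X k))\<^sup>2)) \<longlonglongrightarrow> sqrt l" by (rule tendsto_real_sqrt)
  then show "convergent (\<lambda>k. norm (X k))" by (auto simp: convergent_def)
qed

lemma summable_if_multiple_le:
  fixes f w :: "nat \<Rightarrow> real"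
  assumes "summable w" "0 < a" "\<And>k. 0 \<le> f k" "\<And>k. a * f k \<le> w k"
  shows "summable f"
proof (rule summable_comparison_test)
  show "summable (\<lambda>k. (1 / a) * w k)" using assms(1) by (rule summable_mult)
  show "\<exists>N. \<forall>k\<ge>N. norm (f k) \<le> 1 / a * w k"
    using assms(2-4) by (auto simp: pos_le_divide_eq mult.commute)
qed

section \<open>Averages that are cocoercive\<close>

lemma norm_average_le:
  fixes a :: "nat \<Rightarrow> 'b::real_normed_vector"
  shows "(norm ((1 / real n) *\<^sub>R (\<Sum>i\<in>{1..n}. a i)))\<^sup>2 \<le> (1 / real n) * (\<Sum>i\<in>{1..n}. (norm (a i))\<^sup>2)"
proof (cases "n = 0")
  case False
  have "(norm (\<Sum>i\<in>{1..n}. a i))\<^sup>2 \<le> (\<Sum>i\<in>{1..n}. norm (a i))\<^sup>2"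
    by (intro power_mono norm_sum) auto
  also have "\<dots> \<le> (\<Sum>i\<in>{1..n}. (norm (a i))\<^sup>2) * real n"
    using sum_squared_le_sum_of_squares[of "\<lambda>i. norm (a i)" "{1..n}"] by simp
  finally have "(norm (\<Sum>i\<in>{1..n}. a i))\<^sup>2 / (real n)\<^sup>2 \<le> (\<Sum>i\<in>{1..n}. (norm (a i))\<^sup>2) * real n / (real n)\<^sup>2"
    by (rule divide_right_mono) simp
  then show ?thesis using False by (simp add: power_divide power2_eq_square)
qed simp

text \<open>
With \<open>d\<close> the mean of \<open>|G\<^sub>i x - G\<^sub>i y|\<^sup>2\<close>, cocoercivity and the Cauchy-Schwarz inequality give
\<open>d / L \<le> |G x - G y| |x - y|\<close>, while \<open>|G x - G y|\<^sup>2 \<le> d\<close> by convexity. Combined, they bound \<open>d\<close> itself.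
\<close>

lemma
  fixes G :: "nat \<Rightarrow> real^'p \<Rightarrow> real^'p"
  assumes co: "avg_cocoercive n G L" and L: "0 < L"
  defines "d \<equiv> \<lambda>x y. (1 / real n) * (\<Sum>i\<in>{1..n}. (norm (G i x - G i y))\<^sup>2)"
  shows avg_cocoercive_inner: "d x y / L \<le> (avg_map n G x - avg_map n G y) \<bullet> (x - y)"
    and avg_map_diff_le: "(norm (avg_map n G x - avg_map n G y))\<^sup>2 \<le> d x y"
    and avg_cocoercive_Lipschitz: "d x y \<le> L\<^sup>2 * (norm (x - y))\<^sup>2"
    and avg_map_Lipschitz: "norm (avg_map n G x - avg_map n G y) \<le> L * norm (x - y)"
proof -
  have diff: "avg_map n G x - avg_map n G y = (1 / real n) *\<^sub>R (\<Sum>i\<in>{1..n}. G i x - G i y)"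
    by (simp add: avg_map_def sum_subtractf algebra_simps)
  have "(1 / L) * d x y \<le> (1 / real n) * (\<Sum>i\<in>{1..n}. (G i x - G i y) \<bullet> (x - y))"
    using co unfolding avg_cocoercive_def d_def by blast
  also have "\<dots> = (avg_map n G x - avg_map n G y) \<bullet> (x - y)"
    unfolding diff by (simp add: inner_sum_left)
  finally show 1: "d x y / L \<le> (avg_map n G x - avg_map n G y) \<bullet> (x - y)" by simp
  show 2: "(norm (avg_map n G x - avg_map n G y))\<^sup>2 \<le> d x y"
    unfolding diff d_def by (rule norm_average_le)
  have d0: "0 \<le> d x y" unfolding d_def by (simp add: sum_nonneg)
  have "d x y / L \<le> norm (avg_map n G x - avg_map n G y) * norm (x - y)"
    using 1 norm_cauchy_schwarz order_trans by blast
  then have "d x y \<le> L * norm (x - y) * norm (avg_map n G x - avg_map n G y)"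
    using L by (simp add: field_simps)
  then have "(d x y)\<^sup>2 \<le> (L * norm (x - y))\<^sup>2 * (norm (avg_map n G x - avg_map n G y))\<^sup>2"
    using d0 by (metis power_mono power_mult_distrib)
  also have "\<dots> \<le> (L * norm (x - y))\<^sup>2 * d x y"
    using 2 by (intro mult_left_mono) auto
  finally have sq: "(d x y)\<^sup>2 \<le> (L * norm (x - y))\<^sup>2 * d x y" .
  show 3: "d x y \<le> L\<^sup>2 * (norm (x - y))\<^sup>2"
  proof (cases "d x y = 0")
    case False
    then show ?thesis
      using sq d0 by (simp add: power2_eq_square mult_ac)
  qed simp
  have "(norm (avg_map n G x - avg_map n G y))\<^sup>2 \<le> (L * norm (x - y))\<^sup>2"
    using 2 3 by (simp add: power_mult_distrib)
  then show "norm (avg_map n G x - avg_map n G y) \<le> L * norm (x - y)"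
    by (rule power2_le_imp_le) (use L in simp)
qed

text \<open>
The mean square bound controls each summand separately, at the price of a factor \<open>n\<close>.
\<close>

lemma avg_cocoercive_continuous:
  fixes G :: "nat \<Rightarrow> real^'p \<Rightarrow> real^'p"
  assumes co: "avg_cocoercive n G L" and L: "0 < L" and i: "i \<in> {1..n}"
  shows "continuous_on UNIV (G i)"
proof (rule lipschitz_on_continuous_on, rule lipschitz_onI)
  fix x y
  have n: "0 < real n" using i by simp
  have "(norm (G i x - G i y))\<^sup>2 \<le> (\<Sum>i\<in>{1..n}. (norm (G i x - G i y))\<^sup>2)"
    using i by (intro member_le_sum) auto
  also have "\<dots> \<le> real n * (L\<^sup>2 * (norm (x - y))\<^sup>2)"
    using avg_cocoercive_Lipschitz[OF co L, of x y] n by (simp add: field_simps)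
  finally have "(norm (G i x - G i y))\<^sup>2 \<le> (sqrt (real n) * L * norm (x - y))\<^sup>2"
    by (simp add: power_mult_distrib)
  then have "norm (G i x - G i y) \<le> (sqrt (real n) * L) * norm (x - y)"
    by (rule power2_le_imp_le) (use L in simp)
  then show "dist (G i x) (G i y) \<le> (sqrt (real n) * L) * dist x y"
    by (simp add: dist_norm)
qed (use L in simp)

section \<open>Opial's lemma\<close>

text \<open>
A cluster point is a zero, and the distance to it converges because it converges for points of \<open>S\<close>
arbitrarily close to the cluster point. Requiring convergence on \<open>S\<close> only is what allows a countable
choice that does not depend on the random outcome.
\<close>

lemma opial:
  fixes x :: "nat \<Rightarrow> 'b::euclidean_space"
  assumes cont: "continuous_on UNIV T" and T0: "(\<lambda>k. T (x k)) \<longlonglongrightarrow> (0 :: 'c::real_normed_vector)"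
    and dense: "{z. T z = 0} \<subseteq> closure S" and "S \<noteq> {}"
    and conv: "\<And>p. p \<in> S \<Longrightarrow> convergent (\<lambda>k. norm (x k - p))"
  shows "\<exists>z. T z = 0 \<and> x \<longlonglongrightarrow> z"
proof -
  obtain p where p: "p \<in> S" using \<open>S \<noteq> {}\<close> by auto
  obtain B where B: "\<And>k. norm (x k - p) \<le> B"
    using convergent_imp_Bseq[OF conv[OF p]] by (auto simp: Bseq_def)
  have "\<forall>k. x k \<in> cball p B" using B by (simp add: dist_norm norm_minus_commute)
  then obtain z f where f: "strict_mono f" "(x \<circ> f) \<longlonglongrightarrow> z"
    using compact_cball[of p B] unfolding compact_def by blast
  have "(\<lambda>k. T ((x \<circ> f) k)) \<longlonglongrightarrow> T z"
    using cont f(2) by (intro continuous_on_tendsto_compose[OF cont f(2)]) auto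
  moreover have "(\<lambda>k. T ((x \<circ> f) k)) \<longlonglongrightarrow> 0"
    using LIMSEQ_subseq_LIMSEQ[OF T0 f(1)] by (simp add: o_def)
  ultimately have Tz: "T z = 0" by (rule LIMSEQ_unique)
  have "Cauchy (\<lambda>k. norm (x k - z))"
  proof (rule metric_CauchyI)
    fix \<epsilon> :: real assume \<epsilon>: "0 < \<epsilon>"
    obtain q where q: "q \<in> S" "dist q z < \<epsilon> / 3"
      using dense Tz \<epsilon> closure_approachable[of z S] by (metis (mono_tags) divide_pos_pos mem_Collect_eq subsetD zero_less_numeral)
    have "Cauchy (\<lambda>k. norm (x k - q))"
      using conv[OF q(1)] by (simp add: Cauchy_convergent_iff)
    then obtain N where N: "\<And>k l. N \<le> k \<Longrightarrow> N \<le> l \<Longrightarrow> dist (norm (x k - q)) (norm (x l - q)) < \<epsilon> / 3"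
      using \<epsilon> unfolding Cauchy_def by (metis divide_pos_pos zero_less_numeral)
    have close: "\<bar>norm (x k - z) - norm (x k - q)\<bar> < \<epsilon> / 3" for k
    proof -
      have "\<bar>norm (x k - z) - norm (x k - q)\<bar> \<le> norm ((x k - z) - (x k - q))"
        by (rule norm_triangle_ineq3)
      also have "\<dots> = dist q z" by (simp add: dist_norm)
      finally show ?thesis using q by simp
    qed
    show "\<exists>N. \<forall>k\<ge>N. \<forall>l\<ge>N. dist (norm (x k - z)) (norm (x l - z)) < \<epsilon>"
    proof (intro exI allI impI)
      fix k l assume "N \<le> k" "N \<le> l"
      then have "\<bar>norm (x k - q) - norm (x l - q)\<bar> < \<epsilon> / 3" using N by (simp add: dist_real_def)
      then show "dist (norm (x k - z)) (norm (x l - z)) < \<epsilon>"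
        using close[of k] close[of l] unfolding dist_real_def by linarith
    qed
  qed
  then obtain l where l: "(\<lambda>k. norm (x k - z)) \<longlonglongrightarrow> l"
    by (auto simp: Cauchy_convergent_iff convergent_def)
  have "(\<lambda>k. norm ((x \<circ> f) k - z)) \<longlonglongrightarrow> 0"
    using f(2) by (subst tendsto_norm_zero_iff) (simp only: LIM_zero_iff o_def)
  moreover have "(\<lambda>k. norm ((x \<circ> f) k - z)) \<longlonglongrightarrow> l"
    using LIMSEQ_subseq_LIMSEQ[OF l f(1)] by (simp add: o_def)
  ultimately have "l = 0" using LIMSEQ_unique by blast
  then have "x \<longlonglongrightarrow> z" using l by (simp add: LIM_zero_iff tendsto_norm_zero_iff)
  then show ?thesis using Tz by blast
qed

section \<open>Square-integrable random vectors\<close>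

definition square_integrable :: "'a measure \<Rightarrow> ('a \<Rightarrow> 'b::euclidean_space) \<Rightarrow> bool" where
  "square_integrable M f \<longleftrightarrow> f \<in> borel_measurable M \<and> integrable M (\<lambda>\<omega>. (norm (f \<omega>))\<^sup>2)"

lemma square_integrable_bound:
  fixes f :: "'a \<Rightarrow> 'b::euclidean_space"
  assumes "f \<in> borel_measurable M" "integrable M b" "\<And>\<omega>. \<omega> \<in> space M \<Longrightarrow> (norm (f \<omega>))\<^sup>2 \<le> b \<omega>"
  shows "square_integrable M f"
  unfolding square_integrable_def
proof
  have [measurable]: "f \<in> borel_measurable M" by fact
  show "integrable M (\<lambda>\<omega>. (norm (f \<omega>))\<^sup>2)"
    by (rule Bochner_Integration.integrable_bound[OF assms(2)]) (auto intro!: AE_I2 order_trans[OF assms(3)])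
qed fact

lemma square_integrable_scaleR:
  fixes f :: "'a \<Rightarrow> 'b::euclidean_space"
  assumes "square_integrable M f" shows "square_integrable M (\<lambda>\<omega>. c *\<^sub>R f \<omega>)"
  using assms by (auto simp: square_integrable_def power_mult_distrib)

lemma square_integrable_add:
  fixes f g :: "'a \<Rightarrow> 'b::euclidean_space"
  assumes f: "square_integrable M f" and g: "square_integrable M g"
  shows "square_integrable M (\<lambda>\<omega>. f \<omega> + g \<omega>)"
proof (rule square_integrable_bound)
  show "(\<lambda>\<omega>. f \<omega> + g \<omega>) \<in> borel_measurable M"
    using f g by (auto simp: square_integrable_def)
  show "integrable M (\<lambda>\<omega>. 2 * (norm (f \<omega>))\<^sup>2 + 2 * (norm (g \<omega>))\<^sup>2)"
    using f g by (auto simp: square_integrable_def)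
  fix \<omega>
  have "(norm (f \<omega> + g \<omega>))\<^sup>2 \<le> (norm (f \<omega>) + norm (g \<omega>))\<^sup>2"
    by (intro power_mono norm_triangle_ineq) auto
  also have "\<dots> \<le> 2 * (norm (f \<omega>))\<^sup>2 + 2 * (norm (g \<omega>))\<^sup>2"
    using sum_squares_bound[of "norm (f \<omega>)" "norm (g \<omega>)"] by (simp add: power2_sum)
  finally show "(norm (f \<omega> + g \<omega>))\<^sup>2 \<le> 2 * (norm (f \<omega>))\<^sup>2 + 2 * (norm (g \<omega>))\<^sup>2" .
qed

lemma square_integrable_diff:
  fixes f g :: "'a \<Rightarrow> 'b::euclidean_space"
  assumes "square_integrable M f" "square_integrable M g"
  shows "square_integrable M (\<lambda>\<omega>. f \<omega> - g \<omega>)"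
  using square_integrable_add[OF assms(1) square_integrable_scaleR[OF assms(2), of "-1"]] by simp

lemma square_integrable_inner:
  fixes f g :: "'a \<Rightarrow> 'b::euclidean_space"
  assumes f: "square_integrable M f" and g: "square_integrable M g"
  shows "integrable M (\<lambda>\<omega>. f \<omega> \<bullet> g \<omega>)"
proof (rule Bochner_Integration.integrable_bound)
  show "integrable M (\<lambda>\<omega>. (norm (f \<omega>))\<^sup>2 + (norm (g \<omega>))\<^sup>2)"
    using f g by (auto simp: square_integrable_def)
  show "(\<lambda>\<omega>. f \<omega> \<bullet> g \<omega>) \<in> borel_measurable M"
    using f g by (auto simp: square_integrable_def)
  have "norm (f \<omega> \<bullet> g \<omega>) \<le> norm ((norm (f \<omega>))\<^sup>2 + (norm (g \<omega>))\<^sup>2)" for \<omega>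
    using Cauchy_Schwarz_ineq2[of "f \<omega>" "g \<omega>"] sum_squares_bound[of "norm (f \<omega>)" "norm (g \<omega>)"]
      zero_le_power2[of "norm (f \<omega>)"] zero_le_power2[of "norm (g \<omega>)"]
    by (simp only: real_norm_def)
  then show "AE \<omega> in M. norm (f \<omega> \<bullet> g \<omega>) \<le> norm ((norm (f \<omega>))\<^sup>2 + (norm (g \<omega>))\<^sup>2)" by simp
qed

section \<open>The stochastic iteration\<close>

locale vfkm = prob_space M for M :: "'a measure" +
  fixes F :: "nat \<Rightarrow> 'a measure" and n :: nat and G :: "nat \<Rightarrow> real^'p \<Rightarrow> real^'p"
    and x0 :: "real^'p" and x St :: "nat \<Rightarrow> 'a \<Rightarrow> real^'p" and D :: "nat \<Rightarrow> 'a \<Rightarrow> real"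
    and \<theta> \<gamma> \<eta> :: "nat \<Rightarrow> real" and L \<rho> \<Theta> \<Theta>' r \<beta> :: real
  assumes L_pos: "L > 0"
    and coco: "avg_cocoercive n G L"
    and iterates: "vfkm_iterates M n G \<theta> \<gamma> \<eta> x0 St x"
    and estimator: "vr_unbiased_estimator M F n G \<gamma> x St \<rho> \<Theta> \<Theta>' D"
    and D_0: "AE \<omega> in M. D 0 \<omega> = 0"
    and r_gt_2: "r > 2"
    and \<beta>_pos: "0 < \<beta>"
    and \<beta>_less: "\<beta> < \<rho> / ((\<rho> + (r + 1) * (\<Theta> + \<Theta>')) * L)"
    and \<theta>_eq: "\<And>k. \<theta> k = real k / (real k + r + 2)"
    and \<gamma>_eq: "\<And>k. \<gamma> k = real k / (real k + r)"
    and \<eta>_eq: "\<And>k. \<eta> k = 2 * \<beta> * (real k + r) / (real k + r + 2)"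
begin

definition g :: "nat \<Rightarrow> 'a \<Rightarrow> real^'p" where "g k \<omega> = avg_map n G (x k \<omega>)"
definition v :: "nat \<Rightarrow> 'a \<Rightarrow> real^'p" where "v k \<omega> = x k \<omega> - x (k - 1) \<omega>"
definition U :: "nat \<Rightarrow> 'a \<Rightarrow> real" where "U = U_diff n G x"
definition err :: "nat \<Rightarrow> 'a \<Rightarrow> real^'p" where "err k \<omega> = St k \<omega> - S_dir n G \<gamma> x k \<omega>"
definition noise :: "nat \<Rightarrow> 'a \<Rightarrow> real^'p" where "noise k \<omega> = (2 * \<beta> * (real k + r)) *\<^sub>R err k \<omega>"

text \<open>
The step from \<open>x\<^sup>k\<close> that the exact direction would produce; it is known at time \<open>k\<close>.
\<close>

definition drift :: "nat \<Rightarrow> 'a \<Rightarrow> real^'p" where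
  "drift k \<omega> = (1 / (real k + r + 2)) *\<^sub>R
     (real k *\<^sub>R v k \<omega> - (2 * \<beta> * (real k + r)) *\<^sub>R g k \<omega> + (2 * \<beta> * real k) *\<^sub>R g (k - 1) \<omega>)"

text \<open>
Up to the factor \<open>r\<^sup>2\<close> this is the quantity \<open>\<Delta>\<^sub>k / (1 - \<gamma>\<^sub>k)\<^sup>2\<close> of the variance recursion, because
\<open>1 - \<gamma>\<^sub>k = r / (k + r)\<close>. It matches the size of the squared scaled error, which carries \<open>(k + r)\<^sup>2\<close> too.
\<close>

definition Dh :: "nat \<Rightarrow> 'a \<Rightarrow> real" where "Dh k \<omega> = (real k + r)\<^sup>2 * D k \<omega>"

lemma params: "0 < \<rho>" "\<rho> < 1" "0 < \<Theta>" "0 \<le> \<Theta>'"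
  using estimator unfolding vr_unbiased_estimator_def by blast+

lemma D_nonneg: "\<omega> \<in> space M \<Longrightarrow> 0 \<le> D k \<omega>"
  using estimator unfolding vr_unbiased_estimator_def by blast+

lemma Dh_nonneg: "\<omega> \<in> space M \<Longrightarrow> 0 \<le> Dh k \<omega>"
  by (simp add: Dh_def D_nonneg)

lemma F_sub: "subalgebra M (F k)"
  using estimator unfolding vr_unbiased_estimator_def by blast+

lemma F_mono: "j \<le> k \<Longrightarrow> subalgebra (F k) (F j)"
  using estimator F_sub[of j] F_sub[of k] filtration.sets_F_mono[of "space M" F j k]
  unfolding vr_unbiased_estimator_def subalgebra_def by simp

lemma F_sets: "A \<in> sets (F k) \<Longrightarrow> A \<in> sets M"
  using F_sub by (auto simp: subalgebra_def)

lemma cond_exp_F: "sigma_finite_subalgebra M (F k)"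
  by (intro finite_measure_subalgebra_is_sigma_finite)
    (simp add: finite_measure_subalgebra_def finite_measure_subalgebra_axioms_def F_sub finite_measure_axioms)

lemma meas_M: "f \<in> borel_measurable (F k) \<Longrightarrow> f \<in> borel_measurable M"
  by (rule measurable_from_subalg[OF F_sub])

lemma x_meas: "j \<le> k \<Longrightarrow> x j \<in> borel_measurable (F k)"
  using estimator unfolding vr_unbiased_estimator_def by (blast intro: measurable_from_subalg[OF F_mono])

lemma St_meas: "St k \<in> borel_measurable (F (Suc k))"
  using estimator unfolding vr_unbiased_estimator_def Suc_eq_plus1 by blast

lemma D_meas: "j < k \<Longrightarrow> D j \<in> borel_measurable (F k)"
  using estimator unfolding vr_unbiased_estimator_def
  by (intro measurable_from_subalg[OF F_mono[of "j + 1" k]]) (simp, blast)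

lemma D_meas_M [measurable]: "D k \<in> borel_measurable M"
  using meas_M[OF D_meas[OF lessI]] .

lemma continuous_avg_map: "continuous_on UNIV (avg_map n G)"
  by (rule lipschitz_on_continuous_on[of L], rule lipschitz_onI)
    (use avg_map_Lipschitz[OF coco L_pos] L_pos in \<open>simp_all add: dist_norm\<close>)

lemma g_meas: "j \<le> k \<Longrightarrow> g j \<in> borel_measurable (F k)"
  unfolding g_def
  by (rule measurable_compose[OF x_meas borel_measurable_continuous_onI[OF continuous_avg_map]])

lemma v_meas: "j \<le> k \<Longrightarrow> v j \<in> borel_measurable (F k)"
  unfolding v_def by (intro borel_measurable_diff x_meas) auto

lemma U_meas: "j \<le> k \<Longrightarrow> U j \<in> borel_measurable (F k)"
proof -
  assume j: "j \<le> k"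
  have "(\<lambda>\<omega>. G i (x l \<omega>)) \<in> borel_measurable (F k)" if "i \<in> {1..n}" "l \<le> k" for i l
    by (rule measurable_compose[OF x_meas[OF that(2)]
          borel_measurable_continuous_onI[OF avg_cocoercive_continuous[OF coco L_pos that(1)]]])
  then show ?thesis
    unfolding U_def U_diff_def[abs_def] using j
    by (intro borel_measurable_times borel_measurable_const borel_measurable_sum borel_measurable_power
        borel_measurable_norm[THEN measurable_compose[rotated]] borel_measurable_diff) auto
qed

lemma drift_meas: "drift k \<in> borel_measurable (F k)"
  unfolding drift_def[abs_def]
  by (intro borel_measurable_scaleR borel_measurable_const borel_measurable_add borel_measurable_diff
      v_meas g_meas) auto

lemma S_dir_eq: "S_dir n G \<gamma> x k \<omega> = g k \<omega> - \<gamma> k *\<^sub>R g (k - 1) \<omega>"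
  by (simp add: S_dir_def g_def)

lemma err_meas: "err k \<in> borel_measurable (F (Suc k))"
  unfolding err_def[abs_def] S_dir_eq
  by (intro borel_measurable_scaleR borel_measurable_const borel_measurable_diff St_meas g_meas) auto

lemma err_meas_M [measurable]: "err k \<in> borel_measurable M"
  by (rule meas_M[OF err_meas])

lemma step_x: "\<omega> \<in> space M \<Longrightarrow> x (Suc k) \<omega> = x k \<omega> + \<theta> k *\<^sub>R v k \<omega> - \<eta> k *\<^sub>R St k \<omega>"
  using iterates by (simp add: vfkm_iterates_def v_def)

lemma velocity_step:
  assumes "\<omega> \<in> space M"
  shows "v (Suc k) \<omega> = drift k \<omega> - (1 / (real k + r + 2)) *\<^sub>R noise k \<omega>"
proof -
  have pos: "0 < real k + r" "0 < real k + r + 2" using r_gt_2 by simp_all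
  have St: "St k \<omega> = err k \<omega> + (g k \<omega> - \<gamma> k *\<^sub>R g (k - 1) \<omega>)"
    unfolding err_def S_dir_eq by simp
  have "v (Suc k) \<omega> = \<theta> k *\<^sub>R v k \<omega> - \<eta> k *\<^sub>R g k \<omega> + (\<eta> k * \<gamma> k) *\<^sub>R g (k - 1) \<omega> - \<eta> k *\<^sub>R err k \<omega>"
    using step_x[OF assms, of k] unfolding St by (simp add: v_def algebra_simps)
  moreover have "\<theta> k = (1 / (real k + r + 2)) * real k" 
    "\<eta> k = (1 / (real k + r + 2)) * (2 * \<beta> * (real k + r))"
    "\<eta> k * \<gamma> k = (1 / (real k + r + 2)) * (2 * \<beta> * real k)"
    using pos by (simp_all add: \<theta>_eq \<eta>_eq \<gamma>_eq)
  ultimately show ?thesis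
    unfolding drift_def noise_def by (simp only: scaleR_right_distrib scaleR_right_diff_distrib scaleR_scaleR)
qed

lemma U_nonneg: "0 \<le> U k \<omega>"
  by (simp add: U_def U_diff_def sum_nonneg)

lemma U_le: "U k \<omega> \<le> L\<^sup>2 * (norm (v k \<omega>))\<^sup>2"
  using avg_cocoercive_Lipschitz[OF coco L_pos] by (simp add: U_def U_diff_def v_def)

lemma U_monotone: "U k \<omega> / L \<le> v k \<omega> \<bullet> (g k \<omega> - g (k - 1) \<omega>)"
  using avg_cocoercive_inner[OF coco L_pos, of "x k \<omega>" "x (k - 1) \<omega>"]
  by (simp add: U_def U_diff_def v_def g_def inner_commute)

lemma g_diff_le_U: "(norm (g k \<omega> - g (k - 1) \<omega>))\<^sup>2 \<le> U k \<omega>"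
  using avg_map_diff_le[OF coco L_pos] by (simp add: U_def U_diff_def g_def)

lemma g_monotone: "avg_map n G p = 0 \<Longrightarrow> 0 \<le> (x k \<omega> - p) \<bullet> g k \<omega>"
proof -
  assume "avg_map n G p = 0"
  moreover have "0 \<le> (1 / real n) * (\<Sum>i\<in>{1..n}. (norm (G i (x k \<omega>) - G i p))\<^sup>2) / L"
    using L_pos by (simp add: sum_nonneg)
  ultimately show ?thesis
    using avg_cocoercive_inner[OF coco L_pos, of "x k \<omega>" p] by (simp add: g_def inner_commute)
qed

section \<open>Conditional moments of the error\<close>

lemma nn_integral_err_le_D:
  assumes "1 \<le> k" "A \<in> sets (F k)"
  shows "(\<integral>\<^sup>+\<omega>. indicator A \<omega> * ennreal ((norm (err k \<omega>))\<^sup>2) \<partial>M) \<le> (\<integral>\<^sup>+\<omega>. indicator A \<omega> * ennreal (D k \<omega>) \<partial>M)"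
proof -
  interpret sigma_finite_subalgebra M "F k" by (rule cond_exp_F)
  have ind: "indicator A \<in> borel_measurable (F k)" using assms by simp
  have "AE \<omega> in M. nn_cond_exp M (F k) (\<lambda>\<omega>. ennreal ((norm (err k \<omega>))\<^sup>2)) \<omega>
             \<le> nn_cond_exp M (F k) (\<lambda>\<omega>. ennreal (D k \<omega>)) \<omega>"
    using estimator assms unfolding vr_unbiased_estimator_def err_def by blast
  then have "(\<integral>\<^sup>+\<omega>. indicator A \<omega> * nn_cond_exp M (F k) (\<lambda>\<omega>. ennreal ((norm (err k \<omega>))\<^sup>2)) \<omega> \<partial>M)
      \<le> (\<integral>\<^sup>+\<omega>. indicator A \<omega> * nn_cond_exp M (F k) (\<lambda>\<omega>. ennreal (D k \<omega>)) \<omega> \<partial>M)"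
    by (intro nn_integral_mono_AE) (auto elim!: eventually_mono intro: mult_left_mono)
  then show ?thesis
    by (subst (asm) (1 2) nn_cond_exp_intg[OF ind]) auto
qed

definition D_bound :: "nat \<Rightarrow> 'a \<Rightarrow> real" where
  "D_bound k \<omega> = (1 - \<rho>) * Dh (k - 1) \<omega> + \<Theta> * (real k + r)\<^sup>2 * U k \<omega> + \<Theta>' * (real (k - 1) + r)\<^sup>2 * U (k - 1) \<omega>"

lemma D_bound_nonneg: "\<omega> \<in> space M \<Longrightarrow> 0 \<le> D_bound k \<omega>"
  unfolding D_bound_def using params Dh_nonneg U_nonneg
  by (intro add_nonneg_nonneg mult_nonneg_nonneg) auto

lemma nn_integral_Dh_le:
  assumes "1 \<le> k" "A \<in> sets (F k)"
  shows "(\<integral>\<^sup>+\<omega>. indicator A \<omega> * ennreal (Dh k \<omega>) \<partial>M) \<le> (\<integral>\<^sup>+\<omega>. indicator A \<omega> * ennreal (D_bound k \<omega>) \<partial>M)"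
proof -
  interpret sigma_finite_subalgebra M "F k" by (rule cond_exp_F)
  have ind: "indicator A \<in> borel_measurable (F k)" using assms by simp
  have [measurable]: "A \<in> sets M" using F_sets assms by blast
  let ?C = "nn_cond_exp M (F k) (\<lambda>\<omega>. ennreal (D k \<omega>))"
  have \<gamma>: "1 / (1 - \<gamma> j)\<^sup>2 = (real j + r)\<^sup>2 / r\<^sup>2" for j
  proof -
    have "1 - \<gamma> j = r / (real j + r)" using r_gt_2 by (simp add: \<gamma>_eq field_simps)
    then show ?thesis by (simp add: power_divide)
  qed
  have "AE \<omega> in M. ennreal (1 / (1 - \<gamma> k)\<^sup>2) * ?C \<omega>
             \<le> ennreal ((1 - \<rho>) / (1 - \<gamma> (k - 1))\<^sup>2 * D (k - 1) \<omega>
                 + \<Theta> / (1 - \<gamma> k)\<^sup>2 * U_diff n G x k \<omega>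
                 + \<Theta>' / (1 - \<gamma> (k - 1))\<^sup>2 * U_diff n G x (k - 1) \<omega>)"
    using estimator assms unfolding vr_unbiased_estimator_def by blast
  then have "AE \<omega> in M. ennreal ((real k + r)\<^sup>2) * ?C \<omega> \<le> ennreal (D_bound k \<omega>)"
  proof eventually_elim
    case (elim \<omega>)
    have "(1 - \<rho>) / (1 - \<gamma> (k - 1))\<^sup>2 * D (k - 1) \<omega>
                 + \<Theta> / (1 - \<gamma> k)\<^sup>2 * U_diff n G x k \<omega>
                 + \<Theta>' / (1 - \<gamma> (k - 1))\<^sup>2 * U_diff n G x (k - 1) \<omega>
        = (1 - \<rho>) * (1 / (1 - \<gamma> (k - 1))\<^sup>2) * D (k - 1) \<omega>
                 + \<Theta> * (1 / (1 - \<gamma> k)\<^sup>2) * U k \<omega>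
                 + \<Theta>' * (1 / (1 - \<gamma> (k - 1))\<^sup>2) * U (k - 1) \<omega>"
      by (simp add: U_def)
    also have "\<dots> = D_bound k \<omega> / r\<^sup>2"
      unfolding \<gamma> D_bound_def Dh_def by (simp add: add_divide_distrib)
    finally have "ennreal ((real k + r)\<^sup>2 / r\<^sup>2) * ?C \<omega> \<le> ennreal (D_bound k \<omega> / r\<^sup>2)"
      using elim unfolding \<gamma> by simp
    then have "ennreal (r\<^sup>2) * (ennreal ((real k + r)\<^sup>2 / r\<^sup>2) * ?C \<omega>) \<le> ennreal (r\<^sup>2) * ennreal (D_bound k \<omega> / r\<^sup>2)"
      by (rule mult_left_mono) simp
    then show ?case
      using r_gt_2 by (simp add: mult.assoc[symmetric] ennreal_mult'[symmetric])
  qed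
  then have "(\<integral>\<^sup>+\<omega>. indicator A \<omega> * (ennreal ((real k + r)\<^sup>2) * ?C \<omega>) \<partial>M) \<le> (\<integral>\<^sup>+\<omega>. indicator A \<omega> * ennreal (D_bound k \<omega>) \<partial>M)"
    by (intro nn_integral_mono_AE) (auto elim!: eventually_mono intro: mult_left_mono)
  moreover have "(\<integral>\<^sup>+\<omega>. indicator A \<omega> * (ennreal ((real k + r)\<^sup>2) * ?C \<omega>) \<partial>M) =
      ennreal ((real k + r)\<^sup>2) * (\<integral>\<^sup>+\<omega>. indicator A \<omega> * ?C \<omega> \<partial>M)"
    by (subst nn_integral_cmult[symmetric]) (auto simp: mult_ac)
  moreover have "(\<integral>\<^sup>+\<omega>. indicator A \<omega> * ?C \<omega> \<partial>M) = (\<integral>\<^sup>+\<omega>. indicator A \<omega> * ennreal (D k \<omega>) \<partial>M)"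
    by (rule nn_cond_exp_intg[OF ind]) auto
  moreover have "ennreal ((real k + r)\<^sup>2) * (\<integral>\<^sup>+\<omega>. indicator A \<omega> * ennreal (D k \<omega>) \<partial>M)
      = (\<integral>\<^sup>+\<omega>. indicator A \<omega> * ennreal (Dh k \<omega>) \<partial>M)"
    by (subst nn_integral_cmult[symmetric]) (auto simp: Dh_def ennreal_mult' ac_simps intro!: nn_integral_cong
        simp flip: ennreal_mult'')
  ultimately show ?thesis by simp
qed

lemma square_integrable_g:
  assumes "square_integrable M (x k)"
  shows "square_integrable M (g k)"
proof (rule square_integrable_bound)
  show "g k \<in> borel_measurable M" by (rule meas_M[OF g_meas[OF order_refl]])
  let ?c = "avg_map n G 0"
  show "integrable M (\<lambda>\<omega>. 2 * L\<^sup>2 * (norm (x k \<omega>))\<^sup>2 + 2 * (norm ?c)\<^sup>2)"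
    using assms by (auto simp: square_integrable_def)
  fix \<omega>
  have "norm (g k \<omega>) \<le> norm (g k \<omega> - ?c) + norm ?c"
    by (metis diff_add_cancel norm_triangle_ineq)
  also have "\<dots> \<le> L * norm (x k \<omega>) + norm ?c"
    using avg_map_Lipschitz[OF coco L_pos, of "x k \<omega>" 0] by (simp add: g_def)
  finally have "(norm (g k \<omega>))\<^sup>2 \<le> (L * norm (x k \<omega>) + norm ?c)\<^sup>2"
    by (intro power_mono) auto
  also have "\<dots> \<le> 2 * (L * norm (x k \<omega>))\<^sup>2 + 2 * (norm ?c)\<^sup>2"
    using sum_squares_bound[of "L * norm (x k \<omega>)" "norm ?c"] by (simp add: power2_sum)
  finally show "(norm (g k \<omega>))\<^sup>2 \<le> 2 * L\<^sup>2 * (norm (x k \<omega>))\<^sup>2 + 2 * (norm ?c)\<^sup>2"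
    by (simp add: power_mult_distrib)
qed

lemma integrable_U_if:
  assumes "square_integrable M (x k)" "square_integrable M (x (k - 1))"
  shows "integrable M (U k)"
proof (rule Bochner_Integration.integrable_bound)
  have "square_integrable M (v k)"
    unfolding v_def using assms by (intro square_integrable_diff)
  then show "integrable M (\<lambda>\<omega>. L\<^sup>2 * (norm (v k \<omega>))\<^sup>2)"
    by (auto simp: square_integrable_def)
  show "U k \<in> borel_measurable M" by (rule meas_M[OF U_meas[OF order_refl]])
  show "AE \<omega> in M. norm (U k \<omega>) \<le> norm (L\<^sup>2 * (norm (v k \<omega>))\<^sup>2)"
    using U_nonneg U_le by auto
qed

text \<open>
The starting point \<open>x\<^sup>0\<close> is deterministic and the operators grow at most linearly, so second moments propagate: those up to time \<open>k\<close> bound the mean of \<open>\<Delta>\<^sub>k\<close> by the variance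
recursion, that bounds the variance of the error, and the next iterate is a combination of the former.
\<close>

lemma finite_second_moments: "square_integrable M (x k) \<and> square_integrable M (err k) \<and> integrable M (D k)"
proof (induction k rule: less_induct)
  case (less k)
  have space_k: "space M \<in> sets (F k)"
    using F_sub[of k] sets.top[of "F k"] by (simp add: subalgebra_def)
  have x: "square_integrable M (x k)"
  proof (cases k)
    case 0
    have "square_integrable M (\<lambda>_. x0)" by (simp add: square_integrable_def)
    moreover have "x 0 \<omega> = x0" if "\<omega> \<in> space M" for \<omega>
      using iterates that by (simp add: vfkm_iterates_def)
    ultimately show ?thesis using 0 meas_M[OF x_meas[of 0 0]]
      by (simp add: square_integrable_def cong: Bochner_Integration.integrable_cong)
  next
    case (Suc j)
    have j: "square_integrable M (x j)" "square_integrable M (x (j - 1))" "square_integrable M (err j)"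
      using less Suc by auto
    then have "square_integrable M (\<lambda>\<omega>. x j \<omega> + \<theta> j *\<^sub>R (x j \<omega> - x (j - 1) \<omega>)
        - \<eta> j *\<^sub>R (err j \<omega> + (g j \<omega> - \<gamma> j *\<^sub>R g (j - 1) \<omega>)))" (is "square_integrable M ?f")
      by (intro square_integrable_add square_integrable_diff square_integrable_scaleR square_integrable_g)
    moreover have "x k \<omega> = ?f \<omega>" if "\<omega> \<in> space M" for \<omega>
      using step_x[OF that, of j] Suc by (simp add: v_def err_def S_dir_eq)
    ultimately show ?thesis using meas_M[OF x_meas[of k k]]
      by (simp add: square_integrable_def cong: Bochner_Integration.integrable_cong)
  qed
  have D: "integrable M (D k)"
  proof (cases "k = 0")
    case True
    have "integrable M (D 0) \<longleftrightarrow> integrable M (\<lambda>_. 0 :: real)"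
      using D_0 by (intro integrable_cong_AE) auto
    then show ?thesis using True by simp
  next
    case False
    then have IH: "square_integrable M (x (k - 1))" "square_integrable M (x (k - 1 - 1))" "integrable M (D (k - 1))"
      using less by auto
    have int: "integrable M (D_bound k)"
      unfolding D_bound_def Dh_def
      using integrable_U_if[OF x IH(1)] integrable_U_if[OF IH(1,2)] IH(3) by auto
    have "(\<integral>\<^sup>+\<omega>. ennreal (Dh k \<omega>) \<partial>M) \<le> (\<integral>\<^sup>+\<omega>. ennreal (D_bound k \<omega>) \<partial>M)"
      using nn_integral_Dh_le[of k "space M"] False space_k
      by (simp cong: nn_integral_cong add: indicator_def)
    also have "\<dots> < \<infinity>"
      using int by (subst nn_integral_eq_integral) (auto simp: D_bound_nonneg)
    finally have "integrable M (Dh k)"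
      by (intro integrableI_nonneg) (auto simp: Dh_nonneg Dh_def[abs_def] D_nonneg intro!: AE_I2)
    moreover have "D k = (\<lambda>\<omega>. (1 / (real k + r)\<^sup>2) * Dh k \<omega>)"
      using r_gt_2 by (auto simp: Dh_def)
    ultimately show ?thesis by simp
  qed
  have "square_integrable M (err k)"
  proof (cases "k = 0")
    case True
    have "err 0 \<omega> = 0" if "\<omega> \<in> space M" for \<omega>
      using iterates that by (simp add: vfkm_iterates_def err_def)
    then show ?thesis using True by (simp add: square_integrable_def cong: Bochner_Integration.integrable_cong)
  next
    case False
    have "(\<integral>\<^sup>+\<omega>. ennreal ((norm (err k \<omega>))\<^sup>2) \<partial>M) \<le> (\<integral>\<^sup>+\<omega>. ennreal (D k \<omega>) \<partial>M)"
      using nn_integral_err_le_D[of k "space M"] False space_k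
      by (simp cong: nn_integral_cong add: indicator_def)
    also have "\<dots> < \<infinity>"
      using D by (subst nn_integral_eq_integral) (auto simp: D_nonneg)
    finally show ?thesis
      unfolding square_integrable_def by (auto intro!: integrableI_nonneg)
  qed
  with x D show ?case by simp
qed

lemma square_integrable_processes:
  "square_integrable M (x k)" "square_integrable M (err k)" "square_integrable M (g k)" "square_integrable M (v k)"
  "square_integrable M (drift k)"
proof -
  show x: "square_integrable M (x k)" for k using finite_second_moments by simp
  show "square_integrable M (err k)" using finite_second_moments by simp
  show g: "square_integrable M (g k)" for k by (rule square_integrable_g[OF x])
  show v: "square_integrable M (v k)" for k unfolding v_def by (intro square_integrable_diff x)
  show "square_integrable M (drift k)"
    unfolding drift_def by (intro square_integrable_scaleR square_integrable_add square_integrable_diff g v)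
qed

lemma integrable_processes: "integrable M (D k)" "integrable M (Dh k)" "integrable M (U k)" "integrable M (D_bound k)"
proof -
  show D: "integrable M (D k)" for k using finite_second_moments by simp
  then show Dh: "integrable M (Dh k)" for k unfolding Dh_def[abs_def] by simp
  show U: "integrable M (U k)" for k by (intro integrable_U_if square_integrable_processes)
  show "integrable M (D_bound k)" unfolding D_bound_def[abs_def]
    by (intro Bochner_Integration.integrable_add integrable_mult_right Dh U)
qed

lemma integrable_indicator_mult:
  fixes f :: "'a \<Rightarrow> real"
  assumes "integrable M f" "A \<in> sets (F k)"
  shows "integrable M (\<lambda>\<omega>. indicator A \<omega> * f \<omega>)"
  using integrable_mult_indicator[of A M f] assms F_sets by auto

text \<open>
Transfers the bounds on conditional expectations, which are formulated in the extended nonnegative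
reals, to ordinary integrals.
\<close>

lemma integral_mono_if_nn_integral_mono:
  assumes A: "A \<in> sets (F k)" and f: "integrable M f" "\<And>\<omega>. \<omega> \<in> space M \<Longrightarrow> 0 \<le> f \<omega>"
    and h: "integrable M h" "\<And>\<omega>. \<omega> \<in> space M \<Longrightarrow> 0 \<le> h \<omega>"
    and le: "(\<integral>\<^sup>+\<omega>. indicator A \<omega> * ennreal (f \<omega>) \<partial>M) \<le> (\<integral>\<^sup>+\<omega>. indicator A \<omega> * ennreal (h \<omega>) \<partial>M)"
  shows "(\<integral>\<omega>. indicator A \<omega> * f \<omega> \<partial>M) \<le> (\<integral>\<omega>. indicator A \<omega> * h \<omega> \<partial>M)"
proof -
  have eq: "(\<integral>\<^sup>+\<omega>. indicator A \<omega> * ennreal (q \<omega>) \<partial>M) = ennreal (\<integral>\<omega>. indicator A \<omega> * q \<omega> \<partial>M)"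
    if "integrable M q" "\<And>\<omega>. \<omega> \<in> space M \<Longrightarrow> 0 \<le> q \<omega>" for q
  proof -
    have "(\<integral>\<^sup>+\<omega>. indicator A \<omega> * ennreal (q \<omega>) \<partial>M) = (\<integral>\<^sup>+\<omega>. ennreal (indicator A \<omega> * q \<omega>) \<partial>M)"
      by (intro nn_integral_cong) (simp split: split_indicator)
    then show ?thesis
      using integrable_indicator_mult[OF that(1) A] that(2) by (subst (asm) nn_integral_eq_integral) auto
  qed
  have "0 \<le> (\<integral>\<omega>. indicator A \<omega> * h \<omega> \<partial>M)"
    using h by (intro integral_nonneg_AE AE_I2) auto
  then show ?thesis using le by (simp only: eq[OF f] eq[OF h] ennreal_le_iff)
qed

lemma integral_err_le:
  assumes "1 \<le> k" "A \<in> sets (F k)"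
  shows "(\<integral>\<omega>. indicator A \<omega> * (norm (noise k \<omega>))\<^sup>2 \<partial>M) \<le> 4 * \<beta>\<^sup>2 * (\<integral>\<omega>. indicator A \<omega> * Dh k \<omega> \<partial>M)"
proof -
  have "(\<integral>\<omega>. indicator A \<omega> * (norm (err k \<omega>))\<^sup>2 \<partial>M) \<le> (\<integral>\<omega>. indicator A \<omega> * D k \<omega> \<partial>M)"
    using square_integrable_processes(2)[of k]
    by (intro integral_mono_if_nn_integral_mono[OF assms(2)] nn_integral_err_le_D assms integrable_processes)
      (auto simp: square_integrable_def D_nonneg)
  then have "(4 * \<beta>\<^sup>2 * (real k + r)\<^sup>2) * (\<integral>\<omega>. indicator A \<omega> * (norm (err k \<omega>))\<^sup>2 \<partial>M)
      \<le> (4 * \<beta>\<^sup>2 * (real k + r)\<^sup>2) * (\<integral>\<omega>. indicator A \<omega> * D k \<omega> \<partial>M)"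
    by (rule mult_left_mono) simp
  then show ?thesis
    by (simp add: noise_def Dh_def power_mult_distrib flip: integral_mult_right_zero) (simp only: mult_ac)
qed

lemma integral_Dh_le:
  assumes "1 \<le> k" "A \<in> sets (F k)"
  shows "(\<integral>\<omega>. indicator A \<omega> * Dh k \<omega> \<partial>M) \<le> (\<integral>\<omega>. indicator A \<omega> * D_bound k \<omega> \<partial>M)"
  by (intro integral_mono_if_nn_integral_mono[OF assms(2)] nn_integral_Dh_le assms integrable_processes
      Dh_nonneg D_bound_nonneg)

text \<open>
Unbiasedness is a statement about each coordinate, so the inner product is summed coordinatewise.
\<close>

lemma integral_inner_err_eq_0:
  assumes k: "1 \<le> k" and h: "h \<in> borel_measurable (F k)" "square_integrable M h"
  shows "(\<integral>\<omega>. h \<omega> \<bullet> err k \<omega> \<partial>M) = 0"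
proof -
  interpret sigma_finite_subalgebra M "F k" by (rule cond_exp_F)
  have nth: "(\<lambda>\<omega>. f \<omega> $ i) \<in> borel_measurable N" if "f \<in> borel_measurable N"
    for f :: "'a \<Rightarrow> real^'p" and N i
    by (rule measurable_compose[OF that borel_measurable_continuous_onI[OF continuous_on_component[OF continuous_on_id]]])
  have comp: "square_integrable M (\<lambda>\<omega>. f \<omega> $ i)" if "square_integrable M f" for f :: "'a \<Rightarrow> real^'p" and i
  proof (rule square_integrable_bound)
    show "(\<lambda>\<omega>. f \<omega> $ i) \<in> borel_measurable M"
      using that by (intro nth) (simp add: square_integrable_def)
    show "integrable M (\<lambda>\<omega>. (norm (f \<omega>))\<^sup>2)" using that by (auto simp: square_integrable_def)
    show "(norm (f \<omega> $ i))\<^sup>2 \<le> (norm (f \<omega>))\<^sup>2" for \<omega>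
      by (intro power_mono Finite_Cartesian_Product.norm_nth_le) auto
  qed
  have int: "integrable M (\<lambda>\<omega>. h \<omega> $ i * err k \<omega> $ i)" for i
    using square_integrable_inner[OF comp[OF h(2)] comp[OF square_integrable_processes(2)], of i k i] by simp
  have zero: "(\<integral>\<omega>. h \<omega> $ i * err k \<omega> $ i \<partial>M) = 0" for i
  proof -
    have hi: "(\<lambda>\<omega>. h \<omega> $ i) \<in> borel_measurable (F k)"
      using h(1) by (rule nth)
    have "AE \<omega> in M. vec_cond_exp M (F k) (\<lambda>\<omega>. St k \<omega> - S_dir n G \<gamma> x k \<omega>) \<omega> = 0"
      using estimator k unfolding vr_unbiased_estimator_def by blast
    then have "AE \<omega> in M. real_cond_exp M (F k) (\<lambda>\<omega>. err k \<omega> $ i) \<omega> = 0"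
      by eventually_elim (simp add: vec_cond_exp_def vec_eq_iff err_def)
    then have "(\<integral>\<omega>. h \<omega> $ i * real_cond_exp M (F k) (\<lambda>\<omega>. err k \<omega> $ i) \<omega> \<partial>M) = (\<integral>\<omega>. 0 \<partial>M)"
      using hi meas_M[OF hi] by (intro integral_cong_AE) auto
    moreover have "(\<integral>\<omega>. h \<omega> $ i * real_cond_exp M (F k) (\<lambda>\<omega>. err k \<omega> $ i) \<omega> \<partial>M) = (\<integral>\<omega>. h \<omega> $ i * err k \<omega> $ i \<partial>M)"
      by (rule real_cond_exp_intg(2)[OF int hi]) (rule nth[OF err_meas_M])
    ultimately show ?thesis by simp
  qed
  show ?thesis unfolding inner_vec_def inner_real_def by (simp add: Bochner_Integration.integral_sum[OF int] zero)
qed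

lemma integral_inner_noise_eq_0:
  assumes k: "1 \<le> k" and h: "h \<in> borel_measurable (F k)" "square_integrable M h" and A: "A \<in> sets (F k)"
  shows "(\<integral>\<omega>. indicator A \<omega> * (h \<omega> \<bullet> noise k \<omega>) \<partial>M) = 0"
proof -
  let ?h = "\<lambda>\<omega>. indicator A \<omega> *\<^sub>R h \<omega>"
  have "square_integrable M ?h"
  proof (rule square_integrable_bound)
    show "?h \<in> borel_measurable M"
      using h(2) F_sets[OF A] by (auto simp: square_integrable_def)
    show "integrable M (\<lambda>\<omega>. (norm (h \<omega>))\<^sup>2)" using h(2) by (simp add: square_integrable_def)
  qed (simp split: split_indicator)
  moreover have "?h \<in> borel_measurable (F k)" using h(1) A by simp
  ultimately have "(\<integral>\<omega>. ?h \<omega> \<bullet> err k \<omega> \<partial>M) = 0" by (intro integral_inner_err_eq_0 k)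
  then have "(2 * \<beta> * (real k + r)) * (\<integral>\<omega>. ?h \<omega> \<bullet> err k \<omega> \<partial>M) = 0" by simp
  then show ?thesis
    unfolding integral_mult_right_zero[symmetric] by (simp add: noise_def mult_ac)
qed

section \<open>Stochastic descent\<close>

text \<open>
Multiplied out, the bound on \<open>\<beta>\<close> says \<open>\<beta> L (\<rho> + (r + 1) (\<Theta> + \<Theta>')) < \<rho>\<close>. As \<open>r + 1 > 2\<close>, it implies
\<open>(4\<beta>\<^sup>2 / \<rho>) (\<Theta> + \<Theta>') < 2\<beta> (1 / L - \<beta>)\<close>. The left-hand side is what the variance recursion costs in
units of \<open>k\<^sup>2 U\<^sub>k\<close> and the right-hand side what the energy descent supplies; the constants are
chosen in the resulting gaps.
\<close>

lemma descent_constants: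
  obtains \<tau> lam \<nu> \<kappa> where "1 < \<kappa>" "0 < lam" "0 < \<tau>" "4 * \<beta>\<^sup>2 * \<kappa> + lam \<le> \<tau>" "\<tau> * (1 - \<rho>) < lam"
    "\<tau> * (\<Theta> + \<Theta>') < \<nu>" "\<nu> < 2 * \<beta> * (1 / L - \<beta>)"
proof -
  define T where "T = \<Theta> + \<Theta>'"
  have T: "0 < T" using params by (simp add: T_def)
  have "0 < (\<rho> + (r + 1) * T) * L"
    using params T r_gt_2 L_pos by (intro mult_pos_pos add_pos_pos) auto
  then have "\<beta> * ((\<rho> + (r + 1) * T) * L) < \<rho>"
    using \<beta>_less unfolding T_def[symmetric] by (simp add: pos_less_divide_eq)
  moreover have "2 * (\<beta> * T * L) \<le> (r + 1) * (\<beta> * T * L)"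
    using r_gt_2 \<beta>_pos T L_pos by (intro mult_right_mono) auto
  ultimately have "2 * \<beta> * T * L < \<rho> * (1 - \<beta> * L)"
    by (simp add: algebra_simps)
  then have "2 * \<beta> * (2 * \<beta> * T * L) / (\<rho> * L) < 2 * \<beta> * (\<rho> * (1 - \<beta> * L)) / (\<rho> * L)"
    using \<beta>_pos params L_pos by (intro divide_strict_right_mono mult_strict_left_mono) auto
  then have "(4 * \<beta>\<^sup>2 / \<rho>) * T < 2 * \<beta> * (1 / L - \<beta>)"
    using params L_pos by (simp add: power2_eq_square field_simps)
  then have "4 * \<beta>\<^sup>2 / \<rho> < 2 * \<beta> * (1 / L - \<beta>) / T" using T by (simp only: pos_less_divide_eq)
  then obtain \<tau> where \<tau>: "4 * \<beta>\<^sup>2 / \<rho> < \<tau>" "\<tau> < 2 * \<beta> * (1 / L - \<beta>) / T" using dense by blast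
  have "\<tau> * T < 2 * \<beta> * (1 / L - \<beta>)" using \<tau>(2) T by (simp only: pos_less_divide_eq)
  then obtain \<nu> where \<nu>: "\<tau> * T < \<nu>" "\<nu> < 2 * \<beta> * (1 / L - \<beta>)" using dense by blast
  have "0 < 4 * \<beta>\<^sup>2 / \<rho>" using \<beta>_pos params by simp
  then have \<tau>_pos: "0 < \<tau>" using \<tau>(1) by linarith
  have "4 * \<beta>\<^sup>2 < \<tau> * \<rho>" using \<tau>(1) params by (simp only: pos_divide_less_eq)
  then have "\<tau> * (1 - \<rho>) < \<tau> - 4 * \<beta>\<^sup>2" by (simp add: algebra_simps)
  then obtain lam where lam: "\<tau> * (1 - \<rho>) < lam" "lam < \<tau> - 4 * \<beta>\<^sup>2" using dense by blast
  have "0 \<le> \<tau> * (1 - \<rho>)" using \<tau>_pos params by simp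
  then have lam_pos: "0 < lam" using lam(1) by linarith
  have "1 < (\<tau> - lam) / (4 * \<beta>\<^sup>2)" using lam(2) \<beta>_pos by (simp add: pos_less_divide_eq)
  then obtain \<kappa> where \<kappa>: "1 < \<kappa>" "\<kappa> < (\<tau> - lam) / (4 * \<beta>\<^sup>2)" using dense by blast
  have "4 * \<beta>\<^sup>2 * \<kappa> + lam \<le> \<tau>"
    using \<kappa>(2) \<beta>_pos by (simp add: pos_less_divide_eq mult_ac)
  then show thesis using that[OF \<kappa>(1) lam_pos \<tau>_pos _ lam(1)] \<nu> unfolding T_def by blast
qed

definition E :: "real \<Rightarrow> real^'p \<Rightarrow> nat \<Rightarrow> 'a \<Rightarrow> real" where
  "E s p k \<omega> = energy r \<beta> s (real k) (x k \<omega> - p) (v k \<omega>) (g (k - 1) \<omega>)"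

lemma E_meas: "E s p k \<in> borel_measurable (F k)"
proof -
  have [measurable]: "x k \<in> borel_measurable (F k)" "v k \<in> borel_measurable (F k)" "g (k - 1) \<in> borel_measurable (F k)"
    by (intro x_meas v_meas g_meas; simp)+
  show ?thesis
    unfolding E_def[abs_def] energy_def energy_lin_def energy_quad_def by measurable
qed

lemma square_integrable_shift: "square_integrable M (\<lambda>\<omega>. x k \<omega> - p)"
  by (intro square_integrable_diff square_integrable_processes) (simp add: square_integrable_def)

lemma E_integrable: "integrable M (E s p k)"
proof -
  have sq: "integrable M (\<lambda>\<omega>. (norm (f \<omega>))\<^sup>2)" if "square_integrable M f" for f :: "'a \<Rightarrow> real^'p"
    using that by (simp add: square_integrable_def)
  show ?thesis
    unfolding E_def[abs_def] energy_def energy_lin_def energy_quad_def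
    by (intro Bochner_Integration.integrable_add integrable_mult_right sq square_integrable_inner
        square_integrable_shift square_integrable_add square_integrable_scaleR square_integrable_processes)
qed

text \<open>
The energy together with a reserve that pays for the variance inherited from the previous step. The
weight \<open>\<tau>\<close> covers the total price of one unit of \<open>Dh k\<close>: the squared error it causes now, plus
the reserve \<open>lam\<close> it leaves for the next step. The last term pays for the part of the recursion that
refers to \<open>U\<^sub>k\<^sub>-\<^sub>1\<close>.
\<close>

definition lyap :: "real \<Rightarrow> real^'p \<Rightarrow> real \<Rightarrow> real \<Rightarrow> nat \<Rightarrow> 'a \<Rightarrow> real" where
  "lyap s p \<tau> lam k \<omega> = E s p k \<omega> + lam * Dh (k - 1) \<omega> + \<tau> * \<Theta>' * (real (k - 1) + r)\<^sup>2 * U (k - 1) \<omega>"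

definition loss :: "real \<Rightarrow> real \<Rightarrow> real \<Rightarrow> real \<Rightarrow> nat \<Rightarrow> 'a \<Rightarrow> real" where
  "loss \<epsilon> \<tau> lam \<nu> k \<omega> = \<epsilon> * (real k + 1) * ((norm (drift k \<omega>))\<^sup>2 + (norm (g k \<omega>))\<^sup>2)
     + (lam - \<tau> * (1 - \<rho>)) * Dh (k - 1) \<omega> + (\<nu> - \<tau> * (\<Theta> + \<Theta>')) * (real k + r)\<^sup>2 * U k \<omega>"

lemma lyap_meas:
  assumes "1 \<le> k" shows "lyap s p \<tau> lam k \<in> borel_measurable (F k)"
proof -
  have [measurable]: "E s p k \<in> borel_measurable (F k)" "D (k - 1) \<in> borel_measurable (F k)"
    "U (k - 1) \<in> borel_measurable (F k)"
    using assms by (auto intro: E_meas D_meas U_meas)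
  show ?thesis unfolding lyap_def[abs_def] Dh_def by measurable
qed

lemma lyap_integrable: "integrable M (lyap s p \<tau> lam k)"
  unfolding lyap_def[abs_def]
  by (intro Bochner_Integration.integrable_add integrable_mult_right E_integrable integrable_processes)

lemma loss_integrable: "integrable M (loss \<epsilon> \<tau> lam \<nu> k)"
  using square_integrable_processes(3,5)[of k] unfolding loss_def[abs_def] square_integrable_def
  by (intro Bochner_Integration.integrable_add integrable_mult_right integrable_processes) auto

text \<open>
The pathwise energy descent is integrated over an event of the past: the linear error term vanishes,
the squared error is replaced by \<open>Dh k\<close>, and \<open>Dh k\<close> by the right-hand side of its recursion. What
remains of each term after the replacements is its loss.
\<close>

lemma lyap_descent:
  assumes p: "avg_map n G p = 0" and s: "s < r + 1" "(r - 2 * s)\<^sup>2 < 8 * (s - 1)"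
    and \<kappa>: "1 < \<kappa>" "4 * \<beta>\<^sup>2 * \<kappa> + lam \<le> \<tau>" and \<tau>: "0 < \<tau>" and \<nu>: "\<nu> < 2 * \<beta> * (1 / L - \<beta>)"
  obtains \<epsilon> where "0 < \<epsilon>"
    "\<forall>\<^sub>F k in sequentially. \<forall>A\<in>sets (F k).
      (\<integral>\<omega>. indicator A \<omega> * lyap s p \<tau> lam (Suc k) \<omega> \<partial>M)
      \<le> (\<integral>\<omega>. indicator A \<omega> * (lyap s p \<tau> lam k \<omega> - loss \<epsilon> \<tau> lam \<nu> k \<omega>) \<partial>M)"
proof -
  obtain \<epsilon> where \<epsilon>: "0 < \<epsilon>" and step: "\<forall>\<^sub>F k in sequentially. \<forall>(X::real^'p) v g h m n U.
       (real k + r + 2) *\<^sub>R m = real k *\<^sub>R v - (2 * \<beta> * (real k + r)) *\<^sub>R g + (2 * \<beta> * real k) *\<^sub>R h \<longrightarrow>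
       0 \<le> X \<bullet> g \<longrightarrow> U / L \<le> v \<bullet> (g - h) \<longrightarrow> (norm (g - h))\<^sup>2 \<le> U \<longrightarrow>
       energy r \<beta> s (real k + 1) (X + (m - (1 / (real k + r + 2)) *\<^sub>R n)) (m - (1 / (real k + r + 2)) *\<^sub>R n) g
       \<le> energy r \<beta> s (real k) X v h - 2 * \<beta> * (1 / L - \<beta>) * (real k)\<^sup>2 * U
          - \<epsilon> * (real k + 1) * ((norm m)\<^sup>2 + (norm g)\<^sup>2)
          + \<kappa> * (norm n)\<^sup>2 - 2 * (noise_dir r \<beta> s (real k) X m g \<bullet> n)"
    by (rule energy_descent[OF r_gt_2 \<beta>_pos s \<kappa>(1), where 'b = "real^'p"])
  have "\<forall>\<^sub>F k in sequentially. \<nu> * (real k + r)\<^sup>2 \<le> 2 * \<beta> * (1 / L - \<beta>) * (real k)\<^sup>2"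
  proof -
    have "((\<lambda>k. \<nu> * ((real k + r)\<^sup>2 / (real k)\<^sup>2)) \<longlongrightarrow> \<nu> * 1) sequentially"
      by (intro tendsto_mult tendsto_const) real_asymp
    then have "\<forall>\<^sub>F k in sequentially. \<nu> * ((real k + r)\<^sup>2 / (real k)\<^sup>2) < 2 * \<beta> * (1 / L - \<beta>)"
      using \<nu> by (intro order_tendstoD) auto
    then show ?thesis
      using eventually_gt_at_top[of 0]
    proof eventually_elim
      case (elim k)
      then have "\<nu> * ((real k + r)\<^sup>2 / (real k)\<^sup>2) * (real k)\<^sup>2 \<le> 2 * \<beta> * (1 / L - \<beta>) * (real k)\<^sup>2"
        by (intro mult_right_mono) auto
      then show ?case using elim by simp
    qed
  qed
  with step have "\<forall>\<^sub>F k in sequentially. \<forall>A\<in>sets (F k).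
      (\<integral>\<omega>. indicator A \<omega> * lyap s p \<tau> lam (Suc k) \<omega> \<partial>M)
      \<le> (\<integral>\<omega>. indicator A \<omega> * (lyap s p \<tau> lam k \<omega> - loss \<epsilon> \<tau> lam \<nu> k \<omega>) \<partial>M)"
    using eventually_ge_at_top[of 1]
  proof (eventually_elim, intro ballI)
    fix k A
    assume step: "\<forall>(X::real^'p) v g h m n U.
       (real k + r + 2) *\<^sub>R m = real k *\<^sub>R v - (2 * \<beta> * (real k + r)) *\<^sub>R g + (2 * \<beta> * real k) *\<^sub>R h \<longrightarrow>
       0 \<le> X \<bullet> g \<longrightarrow> U / L \<le> v \<bullet> (g - h) \<longrightarrow> (norm (g - h))\<^sup>2 \<le> U \<longrightarrow>
       energy r \<beta> s (real k + 1) (X + (m - (1 / (real k + r + 2)) *\<^sub>R n)) (m - (1 / (real k + r + 2)) *\<^sub>R n) g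
       \<le> energy r \<beta> s (real k) X v h - 2 * \<beta> * (1 / L - \<beta>) * (real k)\<^sup>2 * U
          - \<epsilon> * (real k + 1) * ((norm m)\<^sup>2 + (norm g)\<^sup>2)
          + \<kappa> * (norm n)\<^sup>2 - 2 * (noise_dir r \<beta> s (real k) X m g \<bullet> n)"
      and \<nu>k: "\<nu> * (real k + r)\<^sup>2 \<le> 2 * \<beta> * (1 / L - \<beta>) * (real k)\<^sup>2"
      and k: "1 \<le> k" and A: "A \<in> sets (F k)"
    \<comment> \<open>The part of the bound on the next Lyapunov value that is known at time \<open>k\<close>.\<close>
    define Z where "Z \<omega> = E s p k \<omega> - \<nu> * (real k + r)\<^sup>2 * U k \<omega>
        - \<epsilon> * (real k + 1) * ((norm (drift k \<omega>))\<^sup>2 + (norm (g k \<omega>))\<^sup>2)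
        + \<tau> * \<Theta>' * (real k + r)\<^sup>2 * U k \<omega>" for \<omega>
    define h where "h \<omega> = noise_dir r \<beta> s (real k) (x k \<omega> - p) (drift k \<omega>) (g k \<omega>)" for \<omega>
    have pathwise: "lyap s p \<tau> lam (Suc k) \<omega> \<le> Z \<omega> + \<kappa> * (norm (noise k \<omega>))\<^sup>2 - 2 * (h \<omega> \<bullet> noise k \<omega>) + lam * Dh k \<omega>"
      if \<omega>: "\<omega> \<in> space M" for \<omega>
    proof -
      have pos: "real k + r + 2 \<noteq> 0" using r_gt_2 by simp
      have X: "(x k \<omega> - p) + v (Suc k) \<omega> = x (Suc k) \<omega> - p" by (simp add: v_def)
      have "E s p (Suc k) \<omega> = energy r \<beta> s (real k + 1)
          ((x k \<omega> - p) + (drift k \<omega> - (1 / (real k + r + 2)) *\<^sub>R noise k \<omega>))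
          (drift k \<omega> - (1 / (real k + r + 2)) *\<^sub>R noise k \<omega>) (g k \<omega>)"
        unfolding E_def velocity_step[OF \<omega>, symmetric] X by (simp add: add.commute)
      also have "\<dots> \<le> E s p k \<omega> - 2 * \<beta> * (1 / L - \<beta>) * (real k)\<^sup>2 * U k \<omega>
          - \<epsilon> * (real k + 1) * ((norm (drift k \<omega>))\<^sup>2 + (norm (g k \<omega>))\<^sup>2)
          + \<kappa> * (norm (noise k \<omega>))\<^sup>2 - 2 * (h \<omega> \<bullet> noise k \<omega>)"
        unfolding E_def h_def
        by (rule step[rule_format, OF _ g_monotone[OF p] U_monotone g_diff_le_U])
          (use pos in \<open>simp add: drift_def\<close>)
      finally have "E s p (Suc k) \<omega> \<le> \<dots>" .
      moreover have "\<nu> * (real k + r)\<^sup>2 * U k \<omega> \<le> 2 * \<beta> * (1 / L - \<beta>) * (real k)\<^sup>2 * U k \<omega>"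
        by (rule mult_right_mono[OF \<nu>k U_nonneg])
      ultimately show ?thesis by (simp add: lyap_def Z_def)
    qed
    note sq = square_integrable_processes[of k]
    have h_sq: "square_integrable M h"
      unfolding h_def[abs_def] noise_dir_def Let_def
      by (intro square_integrable_add square_integrable_scaleR square_integrable_shift sq)
    have h_meas: "h \<in> borel_measurable (F k)"
      unfolding h_def[abs_def] noise_dir_def Let_def
      by (intro borel_measurable_add borel_measurable_scaleR borel_measurable_const borel_measurable_diff
          x_meas drift_meas g_meas) auto
    have n_sq: "square_integrable M (noise k)"
      unfolding noise_def[abs_def] by (intro square_integrable_scaleR sq)
    have n_int: "integrable M (\<lambda>\<omega>. (norm (noise k \<omega>))\<^sup>2)"
      using n_sq by (simp add: square_integrable_def)
    have Z_int: "integrable M Z"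
      using sq(3,5) unfolding Z_def[abs_def] square_integrable_def
      by (intro Bochner_Integration.integrable_add Bochner_Integration.integrable_diff integrable_mult_right
          E_integrable integrable_processes) auto
    note ind = integrable_indicator_mult[OF _ A]
    have "(\<integral>\<omega>. indicator A \<omega> * lyap s p \<tau> lam (Suc k) \<omega> \<partial>M)
      \<le> (\<integral>\<omega>. indicator A \<omega> * Z \<omega> + \<kappa> * (indicator A \<omega> * (norm (noise k \<omega>))\<^sup>2)
           - 2 * (indicator A \<omega> * (h \<omega> \<bullet> noise k \<omega>)) + lam * (indicator A \<omega> * Dh k \<omega>) \<partial>M)"
    proof (rule integral_mono)
      fix \<omega> assume "\<omega> \<in> space M"
      from pathwise[OF this] show "indicator A \<omega> * lyap s p \<tau> lam (Suc k) \<omega> \<le>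
         indicator A \<omega> * Z \<omega> + \<kappa> * (indicator A \<omega> * (norm (noise k \<omega>))\<^sup>2)
           - 2 * (indicator A \<omega> * (h \<omega> \<bullet> noise k \<omega>)) + lam * (indicator A \<omega> * Dh k \<omega>)"
        by (simp split: split_indicator)
    qed (intro Bochner_Integration.integrable_add Bochner_Integration.integrable_diff integrable_mult_right
        ind lyap_integrable Z_int n_int square_integrable_inner h_sq n_sq integrable_processes)+
    also have "\<dots> = (\<integral>\<omega>. indicator A \<omega> * Z \<omega> \<partial>M) + \<kappa> * (\<integral>\<omega>. indicator A \<omega> * (norm (noise k \<omega>))\<^sup>2 \<partial>M)
        - 2 * (\<integral>\<omega>. indicator A \<omega> * (h \<omega> \<bullet> noise k \<omega>) \<partial>M) + lam * (\<integral>\<omega>. indicator A \<omega> * Dh k \<omega> \<partial>M)"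
      using ind[OF Z_int] ind[OF n_int] ind[OF square_integrable_inner[OF h_sq n_sq]]
        ind[OF integrable_processes(2)[of k]] by simp
    also have "(\<integral>\<omega>. indicator A \<omega> * (h \<omega> \<bullet> noise k \<omega>) \<partial>M) = 0"
      by (rule integral_inner_noise_eq_0[OF k h_meas h_sq A])
    also have "(\<integral>\<omega>. indicator A \<omega> * Z \<omega> \<partial>M) + \<kappa> * (\<integral>\<omega>. indicator A \<omega> * (norm (noise k \<omega>))\<^sup>2 \<partial>M)
        - 2 * 0 + lam * (\<integral>\<omega>. indicator A \<omega> * Dh k \<omega> \<partial>M)
      \<le> (\<integral>\<omega>. indicator A \<omega> * Z \<omega> \<partial>M) + \<tau> * (\<integral>\<omega>. indicator A \<omega> * D_bound k \<omega> \<partial>M)"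
    proof -
      let ?I = "\<integral>\<omega>. indicator A \<omega> * Dh k \<omega> \<partial>M"
      have "0 \<le> ?I" by (intro integral_nonneg_AE AE_I2) (simp add: Dh_nonneg)
      have "\<kappa> * (\<integral>\<omega>. indicator A \<omega> * (norm (noise k \<omega>))\<^sup>2 \<partial>M) \<le> \<kappa> * (4 * \<beta>\<^sup>2 * ?I)"
        using \<kappa> integral_err_le[OF k A] by (intro mult_left_mono) auto
      moreover have "(4 * \<beta>\<^sup>2 * \<kappa> + lam) * ?I \<le> \<tau> * ?I"
        using \<kappa> \<open>0 \<le> ?I\<close> by (intro mult_right_mono)
      moreover have "\<tau> * ?I \<le> \<tau> * (\<integral>\<omega>. indicator A \<omega> * D_bound k \<omega> \<partial>M)"
        using \<tau> integral_Dh_le[OF k A] by (intro mult_left_mono) auto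
      ultimately show ?thesis by (simp add: algebra_simps)
    qed
    also have "\<dots> = (\<integral>\<omega>. indicator A \<omega> * (Z \<omega> + \<tau> * D_bound k \<omega>) \<partial>M)"
    proof -
      have "(\<integral>\<omega>. indicator A \<omega> * (Z \<omega> + \<tau> * D_bound k \<omega>) \<partial>M)
          = (\<integral>\<omega>. indicator A \<omega> * Z \<omega> + \<tau> * (indicator A \<omega> * D_bound k \<omega>) \<partial>M)"
        by (simp add: algebra_simps)
      then show ?thesis using ind[OF Z_int] ind[OF integrable_processes(4)[of k]] by simp
    qed
    also have "(\<lambda>\<omega>. Z \<omega> + \<tau> * D_bound k \<omega>) = (\<lambda>\<omega>. lyap s p \<tau> lam k \<omega> - loss \<epsilon> \<tau> lam \<nu> k \<omega>)"
      by (simp add: Z_def D_bound_def lyap_def loss_def algebra_simps)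
    finally show "(\<integral>\<omega>. indicator A \<omega> * lyap s p \<tau> lam (Suc k) \<omega> \<partial>M)
      \<le> (\<integral>\<omega>. indicator A \<omega> * (lyap s p \<tau> lam k \<omega> - loss \<epsilon> \<tau> lam \<nu> k \<omega>) \<partial>M)" .
  qed
  with \<epsilon> show thesis by (rule that)
qed

lemma E_nonneg:
  assumes p: "avg_map n G p = 0" and s: "0 < s" "s < r + 1"
  shows "\<forall>\<^sub>F k in sequentially. \<forall>\<omega>. 0 \<le> E s p k \<omega>"
  using energy_nonneg[OF \<beta>_pos s, where 'b = "real^'p"]
proof eventually_elim
  case (elim k)
  have "x k \<omega> - p - v k \<omega> = x (k - 1) \<omega> - p" for \<omega> by (simp add: v_def)
  then show ?case unfolding E_def using elim g_monotone[OF p] by metis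
qed

section \<open>Almost sure limits\<close>

text \<open>
The tail of the Lyapunov process is a nonnegative supermartingale. All its parts other than the energy
are summable, hence null, so the energy itself converges. The scaled errors are square-summable since
their expected squares are dominated by the expected losses of the following step.
\<close>

lemma energy_converges_AE:
  assumes p: "avg_map n G p = 0" and s: "s < r + 1" "(r - 2 * s)\<^sup>2 < 8 * (s - 1)"
  shows "AE \<omega> in M. convergent (\<lambda>k. E s p k \<omega>)"
    and "AE \<omega> in M. summable (\<lambda>k. (real k + 1) * ((norm (drift k \<omega>))\<^sup>2 + (norm (g k \<omega>))\<^sup>2))"
    and "AE \<omega> in M. summable (\<lambda>k. (norm (noise k \<omega>))\<^sup>2)"
proof -
  have "0 < 8 * (s - 1)" using s(2) by (rule le_less_trans[rotated]) simp
  then have s0: "0 < s" by simp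
  obtain \<tau> lam \<nu> \<kappa> where c: "1 < \<kappa>" "0 < lam" "0 < \<tau>" "4 * \<beta>\<^sup>2 * \<kappa> + lam \<le> \<tau>" "\<tau> * (1 - \<rho>) < lam"
    "\<tau> * (\<Theta> + \<Theta>') < \<nu>" "\<nu> < 2 * \<beta> * (1 / L - \<beta>)"
    by (rule descent_constants)
  obtain \<epsilon> where \<epsilon>: "0 < \<epsilon>" and "\<forall>\<^sub>F k in sequentially. \<forall>A\<in>sets (F k).
      (\<integral>\<omega>. indicator A \<omega> * lyap s p \<tau> lam (Suc k) \<omega> \<partial>M)
      \<le> (\<integral>\<omega>. indicator A \<omega> * (lyap s p \<tau> lam k \<omega> - loss \<epsilon> \<tau> lam \<nu> k \<omega>) \<partial>M)"
    by (rule lyap_descent[OF p s c(1,4,3,7)])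
  with E_nonneg[OF p s0 s(1)] eventually_ge_at_top[of "1::nat"]
  have "\<forall>\<^sub>F k in sequentially. 1 \<le> k \<and> (\<forall>\<omega>. 0 \<le> E s p k \<omega>) \<and> (\<forall>A\<in>sets (F k).
      (\<integral>\<omega>. indicator A \<omega> * lyap s p \<tau> lam (Suc k) \<omega> \<partial>M)
      \<le> (\<integral>\<omega>. indicator A \<omega> * (lyap s p \<tau> lam k \<omega> - loss \<epsilon> \<tau> lam \<nu> k \<omega>) \<partial>M))"
    by (simp add: eventually_conj_iff)
  then obtain k0 where k0: "\<And>k. k0 \<le> k \<Longrightarrow> 1 \<le> k \<and> (\<forall>\<omega>. 0 \<le> E s p k \<omega>) \<and> (\<forall>A\<in>sets (F k).
      (\<integral>\<omega>. indicator A \<omega> * lyap s p \<tau> lam (Suc k) \<omega> \<partial>M)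
      \<le> (\<integral>\<omega>. indicator A \<omega> * (lyap s p \<tau> lam k \<omega> - loss \<epsilon> \<tau> lam \<nu> k \<omega>) \<partial>M))"
    unfolding eventually_sequentially by blast
  let ?V = "\<lambda>k. lyap s p \<tau> lam (k + k0)" and ?W = "\<lambda>k. loss \<epsilon> \<tau> lam \<nu> (k + k0)"
  define a1 a2 where "a1 = lam - \<tau> * (1 - \<rho>)" and "a2 = \<nu> - \<tau> * (\<Theta> + \<Theta>')"
  have a: "0 < a1" "0 < a2" using c by (simp_all add: a1_def a2_def)
  have loss_eq: "loss \<epsilon> \<tau> lam \<nu> k \<omega> = \<epsilon> * (real k + 1) * ((norm (drift k \<omega>))\<^sup>2 + (norm (g k \<omega>))\<^sup>2)
     + a1 * Dh (k - 1) \<omega> + a2 * ((real k + r)\<^sup>2 * U k \<omega>)" for k \<omega>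
    by (simp add: loss_def a1_def a2_def)
  have terms: "0 \<le> \<epsilon> * (real k + 1) * ((norm (drift k \<omega>))\<^sup>2 + (norm (g k \<omega>))\<^sup>2)"
    "0 \<le> a1 * Dh (k - 1) \<omega>" "0 \<le> a2 * ((real k + r)\<^sup>2 * U k \<omega>)" if "\<omega> \<in> space M" for k \<omega>
    using a \<epsilon> Dh_nonneg[OF that] U_nonneg by (simp_all)
  have V_nonneg: "0 \<le> ?V k \<omega>" if "\<omega> \<in> space M" for k \<omega>
    unfolding lyap_def using k0[of "k + k0"] c params Dh_nonneg[OF that] U_nonneg
    by (intro add_nonneg_nonneg mult_nonneg_nonneg) auto
  have W_nonneg: "0 \<le> ?W k \<omega>" if "\<omega> \<in> space M" for k \<omega>
    unfolding loss_eq using terms[OF that] by (intro add_nonneg_nonneg)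
  have super: "(\<integral>\<omega>. indicator A \<omega> * ?V (Suc k) \<omega> \<partial>M) \<le> (\<integral>\<omega>. indicator A \<omega> * (?V k \<omega> - ?W k \<omega>) \<partial>M)"
    if "A \<in> sets (F (k + k0))" for k A
    using k0[of "k + k0"] that by simp
  note conv = almost_supermartingale_converges[where F = "\<lambda>k. F (k + k0)" and V = ?V and W = ?W,
      OF F_sub F_mono lyap_meas lyap_integrable V_nonneg loss_integrable W_nonneg super]
  have V: "AE \<omega> in M. convergent (\<lambda>k. ?V k \<omega>)" and EW: "summable (\<lambda>k. integral\<^sup>L M (?W k))"
    and W: "AE \<omega> in M. summable (\<lambda>k. ?W k \<omega>)"
    using conv k0 by (auto simp: )
  show "AE \<omega> in M. summable (\<lambda>k. (real k + 1) * ((norm (drift k \<omega>))\<^sup>2 + (norm (g k \<omega>))\<^sup>2))"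
    using W AE_space
  proof eventually_elim
    case (elim \<omega>)
    have "summable (\<lambda>k. (real (k + k0) + 1) * ((norm (drift (k + k0) \<omega>))\<^sup>2 + (norm (g (k + k0) \<omega>))\<^sup>2))"
    proof (rule summable_if_multiple_le[OF elim(1) \<epsilon>])
      fix k
      show "\<epsilon> * ((real (k + k0) + 1) * ((norm (drift (k + k0) \<omega>))\<^sup>2 + (norm (g (k + k0) \<omega>))\<^sup>2)) \<le> ?W k \<omega>"
        using terms[OF elim(2), of "k + k0"] by (simp add: loss_eq mult.assoc)
    qed simp
    then show ?case by (rule summable_iff_shift[THEN iffD1])
  qed
  show "AE \<omega> in M. convergent (\<lambda>k. E s p k \<omega>)"
    using V W AE_space
  proof eventually_elim
    case (elim \<omega>)
    have "summable (\<lambda>k. Dh (k + k0 - 1) \<omega>)"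
    proof (rule summable_if_multiple_le[OF elim(2) a(1)])
      fix k
      show "a1 * Dh (k + k0 - 1) \<omega> \<le> ?W k \<omega>"
        using terms[OF elim(3), of "k + k0"] by (simp add: loss_eq)
    qed (rule Dh_nonneg[OF elim(3)])
    moreover have "summable (\<lambda>k. (real (k + k0 - 1) + r)\<^sup>2 * U (k + k0 - 1) \<omega>)"
    proof -
      have "summable (\<lambda>k. (real (k + k0) + r)\<^sup>2 * U (k + k0) \<omega>)"
      proof (rule summable_if_multiple_le[OF elim(2) a(2)])
        fix k
        show "a2 * ((real (k + k0) + r)\<^sup>2 * U (k + k0) \<omega>) \<le> ?W k \<omega>"
          using terms[OF elim(3), of "k + k0"] by (simp add: loss_eq)
      qed (simp add: U_nonneg)
      then have "summable (\<lambda>k. (real k + r)\<^sup>2 * U k \<omega>)" by (rule summable_iff_shift[THEN iffD1])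
      then have "summable (\<lambda>k. (real (k + (k0 - 1)) + r)\<^sup>2 * U (k + (k0 - 1)) \<omega>)"
        by (rule summable_iff_shift[THEN iffD2])
      moreover have "k + (k0 - 1) = k + k0 - 1" for k using k0[of k0] by simp
      ultimately show ?thesis by (simp only:)
    qed
    ultimately have "convergent (\<lambda>k. Dh (k + k0 - 1) \<omega>)" "convergent (\<lambda>k. (real (k + k0 - 1) + r)\<^sup>2 * U (k + k0 - 1) \<omega>)"
      using summable_LIMSEQ_zero convergentI by blast+
    then have "convergent (\<lambda>k. ?V k \<omega> - (lam * Dh (k + k0 - 1) \<omega>
        + \<tau> * \<Theta>' * ((real (k + k0 - 1) + r)\<^sup>2 * U (k + k0 - 1) \<omega>)))"
      using elim(1) by (intro convergent_diff convergent_add convergent_mult[OF convergent_const])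
    then have "convergent (\<lambda>k. E s p (k + k0) \<omega>)" by (simp add: lyap_def mult.assoc)
    then show ?case by (rule convergent_ignore_initial_segment[THEN iffD1])
  qed
  have "summable (\<lambda>k. integral\<^sup>L M (\<lambda>\<omega>. (norm (noise (k + k0) \<omega>))\<^sup>2))"
  proof (rule summable_comparison_test'[where N = 0])
    show "summable (\<lambda>k. 4 * \<beta>\<^sup>2 / a1 * integral\<^sup>L M (?W (k + 1)))"
      by (intro summable_mult summable_ignore_initial_segment EW)
    fix k
    have sp: "space M \<in> sets (F (k + k0))"
      using F_sub[of "k + k0"] sets.top[of "F (k + k0)"] by (simp add: subalgebra_def)
    have "integral\<^sup>L M (\<lambda>\<omega>. (norm (noise (k + k0) \<omega>))\<^sup>2) \<le> 4 * \<beta>\<^sup>2 * integral\<^sup>L M (Dh (k + k0))"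
      using integral_err_le[OF _ sp] k0[of "k + k0"]
      by (simp cong: Bochner_Integration.integral_cong)
    also have "integral\<^sup>L M (Dh (k + k0)) \<le> integral\<^sup>L M (\<lambda>\<omega>. 1 / a1 * ?W (k + 1) \<omega>)"
    proof (intro integral_mono integrable_processes integrable_mult_right loss_integrable)
      fix \<omega> assume "\<omega> \<in> space M"
      then have "a1 * Dh (k + k0) \<omega> \<le> ?W (k + 1) \<omega>"
        using terms[of \<omega> "k + 1 + k0"] by (simp add: loss_eq)
      then show "Dh (k + k0) \<omega> \<le> 1 / a1 * ?W (k + 1) \<omega>"
        using a by (simp add: pos_le_divide_eq mult.commute)
    qed
    finally show "norm (integral\<^sup>L M (\<lambda>\<omega>. (norm (noise (k + k0) \<omega>))\<^sup>2)) \<le> 4 * \<beta>\<^sup>2 / a1 * integral\<^sup>L M (?W (k + 1))"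
      using \<beta>_pos by (simp add: integral_nonneg_AE)
  qed
  then have "AE \<omega> in M. summable (\<lambda>k. (norm (noise (k + k0) \<omega>))\<^sup>2)"
    using square_integrable_processes(2)
    by (intro AE_summable_of_summable_integrals)
      (auto simp: noise_def[abs_def] power_mult_distrib square_integrable_def)
  then show "AE \<omega> in M. summable (\<lambda>k. (norm (noise k \<omega>))\<^sup>2)"
    by eventually_elim (rule summable_iff_shift[THEN iffD1])
qed

text \<open>
Both admissible values of \<open>s\<close> are fed into \<open>energies_control_sequence\<close>. Its summability hypothesis
holds since \<open>Q\<^sub>k\<^sub>+\<^sub>1 / (k + 1)\<close> is bounded by the summable weighted squares of drift and operator plus the
squared scaled error, whose coefficient \<open>(k + 1) / (k + r + 2)\<^sup>2\<close> is below 1.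
\<close>

lemma rates_AE:
  assumes p: "avg_map n G p = 0"
  shows "AE \<omega> in M. (\<lambda>k. real k *\<^sub>R v k \<omega>) \<longlonglongrightarrow> 0 \<and> (\<lambda>k. real k *\<^sub>R g (k - 1) \<omega>) \<longlonglongrightarrow> 0
    \<and> convergent (\<lambda>k. norm (x k \<omega> - p))"
proof -
  \<comment> \<open>The value \<open>r / 2\<close> makes the left-hand side of the discriminant condition vanish and needs \<open>r > 2\<close>;
      for \<open>r / 2 + 1\<close> the condition reads \<open>4 < 4 r\<close>.\<close>
  have s1: "r / 2 < r + 1" "(r - 2 * (r / 2))\<^sup>2 < 8 * (r / 2 - 1)" using r_gt_2 by simp_all
  have s2: "r / 2 + 1 < r + 1" "(r - 2 * (r / 2 + 1))\<^sup>2 < 8 * (r / 2 + 1 - 1)"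
    using r_gt_2 by (simp_all add: power2_eq_square algebra_simps)
  show ?thesis
    using energy_converges_AE[OF p s1] energy_converges_AE(1)[OF p s2] AE_space
  proof eventually_elim
    case (elim \<omega>)
    let ?D = "\<lambda>k. (norm (drift k \<omega>))\<^sup>2 + (norm (g k \<omega>))\<^sup>2"
    have "summable (\<lambda>k. (3 + 4 * \<beta>\<^sup>2) * ((real k + 1) * ?D k) + 3 * (norm (noise k \<omega>))\<^sup>2)"
      using elim by (intro summable_add summable_mult)
    then have "summable (\<lambda>k. energy_quad \<beta> (real (Suc k)) (v (Suc k) \<omega>) (g (Suc k - 1) \<omega>) / real (Suc k))"
    proof (rule summable_comparison_test'[where N = 0])
      fix k
      let ?c = "1 / (real k + r + 2)"
      have pos: "0 < real k + r + 2" using r_gt_2 by simp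
      have three: "(norm (a - b + d))\<^sup>2 \<le> 3 * (norm a)\<^sup>2 + 3 * (norm b)\<^sup>2 + 3 * (norm d)\<^sup>2" for a b d :: "real^'p"
      proof -
        have "norm (a - b + d) \<le> norm a + norm b + norm d"
          by (metis add_right_mono norm_triangle_ineq norm_triangle_ineq4 order_trans)
        then have "(norm (a - b + d))\<^sup>2 \<le> (norm a + norm b + norm d)\<^sup>2" by (intro power_mono) auto
        also have "\<dots> \<le> 3 * (norm a)\<^sup>2 + 3 * (norm b)\<^sup>2 + 3 * (norm d)\<^sup>2"
          using sum_squares_bound[of "norm a" "norm b"] sum_squares_bound[of "norm a" "norm d"]
            sum_squares_bound[of "norm b" "norm d"] by (simp add: power2_eq_square algebra_simps)
        finally show ?thesis .
      qed
      have c: "(real k + 1) * ?c\<^sup>2 \<le> 1"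
      proof -
        have "(real k + 1) * 1 \<le> (real k + r + 2) * (real k + r + 2)" using r_gt_2 by (intro mult_mono) auto
        then show ?thesis using pos by (simp add: power_divide power2_eq_square)
      qed
      have "energy_quad \<beta> (real (Suc k)) (v (Suc k) \<omega>) (g (Suc k - 1) \<omega>) / real (Suc k)
          = (real k + 1) * ((norm (v (Suc k) \<omega> + \<beta> *\<^sub>R g k \<omega>))\<^sup>2 + \<beta>\<^sup>2 * (norm (g k \<omega>))\<^sup>2)"
        by (simp add: energy_quad_def power2_eq_square add.commute)
      also have "\<dots> \<le> (real k + 1) * (3 * (norm (drift k \<omega>))\<^sup>2 + 3 * (norm (?c *\<^sub>R noise k \<omega>))\<^sup>2
            + 3 * (norm (\<beta> *\<^sub>R g k \<omega>))\<^sup>2 + \<beta>\<^sup>2 * (norm (g k \<omega>))\<^sup>2)"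
        unfolding velocity_step[OF elim(5)] by (intro mult_left_mono add_mono three) auto
      also have "\<dots> = 3 * ((real k + 1) * (norm (drift k \<omega>))\<^sup>2) + 4 * \<beta>\<^sup>2 * ((real k + 1) * (norm (g k \<omega>))\<^sup>2)
          + 3 * ((real k + 1) * ?c\<^sup>2 * (norm (noise k \<omega>))\<^sup>2)"
        by (simp only: norm_scaleR power_mult_distrib power2_abs) (simp add: algebra_simps)
      also have "\<dots> \<le> (3 + 4 * \<beta>\<^sup>2) * ((real k + 1) * (norm (drift k \<omega>))\<^sup>2)
          + (3 + 4 * \<beta>\<^sup>2) * ((real k + 1) * (norm (g k \<omega>))\<^sup>2) + 3 * (1 * (norm (noise k \<omega>))\<^sup>2)"
        by (intro add_mono mult_left_mono mult_right_mono c) auto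
      finally show "norm (energy_quad \<beta> (real (Suc k)) (v (Suc k) \<omega>) (g (Suc k - 1) \<omega>) / real (Suc k))
          \<le> (3 + 4 * \<beta>\<^sup>2) * ((real k + 1) * ?D k) + 3 * (norm (noise k \<omega>))\<^sup>2"
        by (simp add: energy_quad_def distrib_left)
    qed
    then show ?case
      using energies_control_sequence[of \<beta> r "r / 2" "r / 2 + 1" "\<lambda>k. x k \<omega> - p" "\<lambda>k. v k \<omega>" "\<lambda>k. g (k - 1) \<omega>"]
        elim \<beta>_pos r_gt_2 unfolding E_def by simp
  qed
qed

end

theorem theorem2:
  fixes M :: "'a measure" and F :: "nat \<Rightarrow> 'a measure"
    and n :: nat and G :: "nat \<Rightarrow> real^'p \<Rightarrow> real^'p"
    and x0 :: "real^'p" and x St :: "nat \<Rightarrow> 'a \<Rightarrow> real^'p" and D :: "nat \<Rightarrow> 'a \<Rightarrow> real"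
    and \<theta> \<gamma> \<eta> :: "nat \<Rightarrow> real" and L \<rho> \<Theta> \<Theta>' r \<beta> :: real
  assumes "prob_space M"
    and "n \<ge> 1"
    and "zer (avg_map n G) \<noteq> {}"
    and "L > 0"
    and "avg_cocoercive n G L"
    and "vfkm_iterates M n G \<theta> \<gamma> \<eta> x0 St x"
    and "vr_unbiased_estimator M F n G \<gamma> x St \<rho> \<Theta> \<Theta>' D"
    and "AE \<omega> in M. D 0 \<omega> = 0"
    and "r > 2"
    and "0 < \<beta>"
    and "\<beta> < min (\<rho> / ((\<rho> + (r + 1) * (\<Theta> + \<Theta>')) * L)) (1 / ((r + 1) * L))"
    and "\<And>k. \<theta> k = real k / (real k + r + 2)"
    and "\<And>k. \<gamma> k = real k / (real k + r)"
    and "\<And>k. \<eta> k = 2 * \<beta> * (real k + r) / (real k + r + 2)"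
  shows "(AE \<omega> in M. (\<lambda>k. (real k)\<^sup>2 * (norm (x (k + 1) \<omega> - x k \<omega>))\<^sup>2) \<longlonglongrightarrow> 0)
       \<and> (AE \<omega> in M. (\<lambda>k. (real k)\<^sup>2 * (norm (avg_map n G (x k \<omega>)))\<^sup>2) \<longlonglongrightarrow> 0)
       \<and> (\<exists>X. X \<in> borel_measurable M \<and> (\<forall>\<omega>\<in>space M. X \<omega> \<in> zer (avg_map n G)) \<and>
              (AE \<omega> in M. (\<lambda>k. x k \<omega>) \<longlonglongrightarrow> X \<omega>))"
proof -
  interpret prob_space M by fact
  interpret vfkm M F n G x0 x St D \<theta> \<gamma> \<eta> L \<rho> \<Theta> \<Theta>' r \<beta>
    by unfold_locales (use assms in simp_all)
  let ?T = "avg_map n G"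
  obtain S where S: "countable S" "S \<subseteq> zer ?T" "zer ?T \<subseteq> closure S" by (rule separable)
  then have "S \<noteq> {}" using assms(3) by auto
  have all: "AE \<omega> in M. \<forall>p\<in>S. (\<lambda>k. real k *\<^sub>R v k \<omega>) \<longlonglongrightarrow> 0 \<and> (\<lambda>k. real k *\<^sub>R g (k - 1) \<omega>) \<longlonglongrightarrow> 0
    \<and> convergent (\<lambda>k. norm (x k \<omega> - p))"
    using S rates_AE by (subst AE_ball_countable) (auto simp: zer_def)
  have shrink: "(\<lambda>k. (real k)\<^sup>2 * (norm (f k))\<^sup>2) \<longlonglongrightarrow> 0"
    if "(\<lambda>k. real (Suc k) *\<^sub>R f k) \<longlonglongrightarrow> 0" for f :: "nat \<Rightarrow> real^'p"
  proof (rule tendsto_sandwich[OF _ _ tendsto_const])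
    have "(\<lambda>k. (norm (real (Suc k) *\<^sub>R f k))\<^sup>2) \<longlonglongrightarrow> (norm (0 :: real^'p))\<^sup>2"
      using that by (intro tendsto_intros)
    then show "(\<lambda>k. (real (Suc k))\<^sup>2 * (norm (f k))\<^sup>2) \<longlonglongrightarrow> 0" by (simp add: power_mult_distrib)
    show "\<forall>\<^sub>F k in sequentially. (real k)\<^sup>2 * (norm (f k))\<^sup>2 \<le> (real (Suc k))\<^sup>2 * (norm (f k))\<^sup>2"
      by (intro always_eventually allI mult_right_mono power_mono) auto
  qed (auto intro!: always_eventually)
  have "AE \<omega> in M. (\<lambda>k. (real k)\<^sup>2 * (norm (x (k + 1) \<omega> - x k \<omega>))\<^sup>2) \<longlonglongrightarrow> 0"
    using all
  proof eventually_elim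
    case (elim \<omega>)
    then have "(\<lambda>k. real k *\<^sub>R v k \<omega>) \<longlonglongrightarrow> 0" using \<open>S \<noteq> {}\<close> by blast
    from shrink[OF LIMSEQ_Suc[OF this]] show ?case by (simp add: v_def)
  qed
  moreover have g_rate: "AE \<omega> in M. (\<lambda>k. (real k)\<^sup>2 * (norm (?T (x k \<omega>)))\<^sup>2) \<longlonglongrightarrow> 0"
    using all
  proof eventually_elim
    case (elim \<omega>)
    then have "(\<lambda>k. real k *\<^sub>R g (k - 1) \<omega>) \<longlonglongrightarrow> 0" using \<open>S \<noteq> {}\<close> by blast
    from LIMSEQ_Suc[OF this] have "(\<lambda>k. real (Suc k) *\<^sub>R g k \<omega>) \<longlonglongrightarrow> 0" by simp
    from shrink[OF this] show ?case by (simp add: g_def)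
  qed
  moreover have lim: "AE \<omega> in M. \<exists>z. ?T z = 0 \<and> (\<lambda>k. x k \<omega>) \<longlonglongrightarrow> z"
    using all
  proof eventually_elim
    case (elim \<omega>)
    then have "(\<lambda>k. real k *\<^sub>R g (k - 1) \<omega>) \<longlonglongrightarrow> 0" using \<open>S \<noteq> {}\<close> by blast
    from LIMSEQ_Suc[OF this] have "(\<lambda>k. real (Suc k) *\<^sub>R g k \<omega>) \<longlonglongrightarrow> 0" by simp
    then have "(\<lambda>k. (1 / real (Suc k)) *\<^sub>R (real (Suc k) *\<^sub>R g k \<omega>)) \<longlonglongrightarrow> 0 *\<^sub>R 0"
      by (intro tendsto_scaleR LIMSEQ_Suc[OF lim_1_over_n])
    then have "(\<lambda>k. ?T (x k \<omega>)) \<longlonglongrightarrow> 0" by (simp add: g_def)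
    then show ?case
      by (rule opial[OF continuous_avg_map _ _ \<open>S \<noteq> {}\<close>])
        (use S(3) elim in \<open>auto simp: zer_def\<close>)
  qed
  moreover have "\<exists>X. X \<in> borel_measurable M \<and> (\<forall>\<omega>\<in>space M. X \<omega> \<in> zer ?T) \<and> (AE \<omega> in M. (\<lambda>k. x k \<omega>) \<longlonglongrightarrow> X \<omega>)"
  proof -
    obtain q where q: "?T q = 0" using assms(3) by (auto simp: zer_def)
    \<comment> \<open>On the null set without convergence the value of \<open>lim\<close> is arbitrary; it is replaced by a fixed zero \<open>q\<close>.\<close>
    define X where "X \<omega> = (if ?T (lim (\<lambda>k. x k \<omega>)) = 0 then lim (\<lambda>k. x k \<omega>) else q)" for \<omega>
    have [measurable]: "x k \<in> borel_measurable M" for k by (rule meas_M[OF x_meas[OF order_refl]])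
    have [measurable]: "?T \<in> borel_measurable borel" by (rule borel_measurable_continuous_onI[OF continuous_avg_map])
    have "X \<in> borel_measurable M" unfolding X_def[abs_def] by measurable
    moreover have "\<forall>\<omega>\<in>space M. X \<omega> \<in> zer ?T" using q by (simp add: X_def zer_def)
    moreover have "AE \<omega> in M. (\<lambda>k. x k \<omega>) \<longlonglongrightarrow> X \<omega>"
      using lim by eventually_elim (auto simp: X_def limI)
    ultimately show ?thesis by blast
  qed
  ultimately show ?thesis by blast
qed

end
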